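(* Given any numbers $\{\lambda_k,b_k,M\}$ satisfying $$0<\lambda_1<\lambda_2<\cdots<\lambda_{n-1},\qquad b_1,\dots,b_{n-1}<0,\qquad M>0,$$ the formulas $$m_{n-k}=\frac{\mathcal{D}_k^2}{2\,\mathcal{A}_{k+1}\mathcal{A}_k}\quad(0\le k\le n-1),\qquad l_{n-k}=-\frac{2\,\mathcal{A}_k}{\mathcal{D}'_k}\quad(1\le k\le n-1)$$ define a discrete cubic string (that is, masses $m_1,\dots,m_n>0$ and gaps $l_j=x_{j+1}-x_j>0$, $1\le j\le n-1$) with these numbers as spectral data.
   Context: Determinants. With $d\mu(\lambda)=\sum_{k=1}^{n-1}b_k\,\delta(\lambda-\lambda_k)$ put $$\beta_j=\int\lambda^j\,d\mu(\lambda)=\sum_{k=1}^{n-1}b_k\lambda_k^j,\qquad I_{ij}=\iint\frac{\kappa^i\lambda^j}{\kappa+\lambda}\,d\mu(\kappa)d\mu(\lambda)=\sum_{p,q=1}^{n-1}\frac{\lambda_p^i\lambda_q^j}{\lambda_p+\lambda_q}b_pb_q .$$ Set $\mathcal{A}_0=\mathcal{D}_0=1$. For $k\ge1$: $\mathcal{A}_k$ is the $k\times k$ determinant of the matrix $(I_{ij})_{0\le i,j\le k-1}$ with its $(0,0)$ entry replaced by $I_{00}+\frac1{2M}$; $\mathcal{D}_k=\det(I_{ij})_{1\le i\le k,\;0\le j\le k-1}$; and $\mathcal{D}'_k$ is the $k\times k$ determinant whose first column is $(\beta_0,\beta_1,\dots,\beta_{k-1})^t$ and whose remaining columns are $(I_{1j},I_{2j},\dots,I_{kj})^t$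 for $j=0,\dots,k-2$ (so $\mathcal{D}'_1=\beta_0$). Spectral data of a string. Given $x_1<\cdots<x_n$ and $m_1,\dots,m_n>0$, put $l_k=x_{k+1}-x_k$, $$L_k=\begin{pmatrix}1&l_k&l_k^2/2\\0&1&l_k\\0&0&1\end{pmatrix},\qquad G_k(z)=\begin{pmatrix}1&0&0\\0&1&0\\-2m_kz&0&1\end{pmatrix},$$ and define polynomials by $(C(z),B(z),A(z))^t=G_n(z)L_{n-1}G_{n-1}(z)\cdots L_1G_1(z)(1,0,0)^t$. (This is the vector $(\phi,\phi_x,\phi_{xx})^t$ at $x_n^+$, where $-\phi'''=zm\phi$ with $m(x)=2\sum_k m_k\delta(x-x_k)$ and $\phi=1$ for $x<x_1$.) The zeros of $A$ are simple: they are $0$ and $n-1$ positive numbers (the positive eigenvalues); $B(0)=0$. The spectral data of the string are the positive zeros $\lambda_1<\dots<\lambda_{n-1}$ of $A$, the residues $b_k$ in $\frac{B(z)}{A(z)}=\sum_{k=1}^{n-1}\frac{b_k}{z-\lambda_k}$, and $M=\sum_{k=1}^n m_k$. They depend only on the $m_k$ and the gaps $l_k$. *)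

theory Defs
  imports "Jordan_Normal_Form.Determinant" "HOL-Computational_Algebra.Polynomial"
begin

section \<open>Discrete cubic strings and their spectral data\<close>

text \<open>
  A discrete cubic string with \<open>n\<close> point masses is given by positions \<open>x 1 < \<dots> < x n\<close> and
  masses \<open>m 1, \<dots>, m n\<close>.  All families are 1-based functions on \<^typ>\<open>nat\<close>; values outside
  the stated index ranges are never used.
\<close>

definition discrete_cubic_string :: "nat \<Rightarrow> (nat \<Rightarrow> real) \<Rightarrow> (nat \<Rightarrow> real) \<Rightarrow> bool" where
  "discrete_cubic_string n x m \<longleftrightarrow>
     (\<forall>k\<in>{1..<n}. x k < x (k + 1)) \<and> (\<forall>k\<in>{1..n}. 0 < m k)"

definition string_gap :: "(nat \<Rightarrow> real) \<Rightarrow> nat \<Rightarrow> real" where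
  "string_gap x k = x (k + 1) - x k"

definition L_mat :: "real \<Rightarrow> real poly mat" where
  "L_mat l = mat_of_rows_list 3
     [[1, [:l:], [:l\<^sup>2 / 2:]],
      [0, 1,     [:l:]],
      [0, 0,     1]]"

definition G_mat :: "real \<Rightarrow> real poly mat" where
  "G_mat m = mat_of_rows_list 3
     [[1,             0, 0],
      [0,             1, 0],
      [[:0, -2 * m:], 0, 1]]"

text \<open>
  \<open>string_vec x m k\<close> is the vector \<open>(\<phi>, \<phi>\<^sub>x, \<phi>\<^sub>x\<^sub>x)\<close>, polynomial in \<open>z\<close>, just to the right of
  \<open>x k\<close>, where \<open>-\<phi>''' = z m \<phi>\<close> and \<open>\<phi> = 1\<close> to the left of \<open>x 1\<close>.
\<close>

fun string_vec :: "(nat \<Rightarrow> real) \<Rightarrow> (nat \<Rightarrow> real) \<Rightarrow> nat \<Rightarrow> real poly vec" where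
  "string_vec x m 0 = vec_of_list [1, 0, 0]"
| "string_vec x m (Suc 0) = G_mat (m 1) *\<^sub>v vec_of_list [1, 0, 0]"
| "string_vec x m (Suc (Suc k)) =
     G_mat (m (Suc (Suc k))) *\<^sub>v (L_mat (string_gap x (Suc k)) *\<^sub>v string_vec x m (Suc k))"

definition B_poly :: "nat \<Rightarrow> (nat \<Rightarrow> real) \<Rightarrow> (nat \<Rightarrow> real) \<Rightarrow> real poly" where
  "B_poly n x m = string_vec x m n $ 1"

definition A_poly :: "nat \<Rightarrow> (nat \<Rightarrow> real) \<Rightarrow> (nat \<Rightarrow> real) \<Rightarrow> real poly" where
  "A_poly n x m = string_vec x m n $ 2"

text \<open>
  The first two conjuncts say that \<open>lam 1 < \<dots> < lam (n - 1)\<close> enumerates exactly the positive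
  zeros of \<open>A\<close>; in particular \<open>A\<close> is not the zero polynomial, so the partial fraction
  identity holds at all but finitely many real points and determines the \<open>b k\<close>.
\<close>

definition has_spectral_data ::
  "nat \<Rightarrow> (nat \<Rightarrow> real) \<Rightarrow> (nat \<Rightarrow> real) \<Rightarrow> (nat \<Rightarrow> real) \<Rightarrow> (nat \<Rightarrow> real) \<Rightarrow> real \<Rightarrow> bool" where
  "has_spectral_data n x m lam b M \<longleftrightarrow>
     strict_mono_on {1..<n} lam \<and>
     {z. 0 < z \<and> poly (A_poly n x m) z = 0} = lam ` {1..<n} \<and>
     (\<forall>z. poly (A_poly n x m) z \<noteq> 0 \<longrightarrow>
        poly (B_poly n x m) z / poly (A_poly n x m) z = (\<Sum>k\<in>{1..<n}. b k / (z - lam k))) \<and>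
     M = (\<Sum>k\<in>{1..n}. m k)"

section \<open>The determinants\<close>

definition beta :: "nat \<Rightarrow> (nat \<Rightarrow> real) \<Rightarrow> (nat \<Rightarrow> real) \<Rightarrow> nat \<Rightarrow> real" where
  "beta n lam b j = (\<Sum>k\<in>{1..<n}. b k * lam k ^ j)"

definition I_moment :: "nat \<Rightarrow> (nat \<Rightarrow> real) \<Rightarrow> (nat \<Rightarrow> real) \<Rightarrow> nat \<Rightarrow> nat \<Rightarrow> real" where
  "I_moment n lam b i j =
     (\<Sum>p\<in>{1..<n}. \<Sum>q\<in>{1..<n}. lam p ^ i * lam q ^ j / (lam p + lam q) * b p * b q)"

definition A_det :: "nat \<Rightarrow> (nat \<Rightarrow> real) \<Rightarrow> (nat \<Rightarrow> real) \<Rightarrow> real \<Rightarrow> nat \<Rightarrow> real" where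
  "A_det n lam b M k = det (mat k k (\<lambda>(i, j).
     if i = 0 \<and> j = 0 then I_moment n lam b 0 0 + 1 / (2 * M) else I_moment n lam b i j))"

definition D_det :: "nat \<Rightarrow> (nat \<Rightarrow> real) \<Rightarrow> (nat \<Rightarrow> real) \<Rightarrow> nat \<Rightarrow> real" where
  "D_det n lam b k = det (mat k k (\<lambda>(i, j). I_moment n lam b (i + 1) j))"

definition D'_det :: "nat \<Rightarrow> (nat \<Rightarrow> real) \<Rightarrow> (nat \<Rightarrow> real) \<Rightarrow> nat \<Rightarrow> real" where
  "D'_det n lam b k = det (mat k k (\<lambda>(i, j).
     if j = 0 then beta n lam b i else I_moment n lam b (i + 1) (j - 1)))"

text \<open>The convention for \<open>k = 0\<close> is the value of the empty determinant.\<close>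

lemma A_det_0 [simp]: "A_det n lam b M 0 = 1"
  by (simp add: A_det_def)

lemma D_det_0 [simp]: "D_det n lam b 0 = 1"
  by (simp add: D_det_def)

end

theory Submission
  imports Defs
begin

text \<open>
  Write \<open>C\<^sub>k, B\<^sub>k, A\<^sub>k\<close> for the components of the state vector after \<open>k\<close> masses. The invariant form
  yields the Christoffel--Darboux identity
  \<open>(x + y) * (\<Sum>k. 2 m\<^sub>k C\<^sub>k(x) C\<^sub>k(y)) = B(x) B(y) - C(x) A(y) - A(x) C(y)\<close>.
  At the zeros of \<open>A\<close> only \<open>B(x) B(y)\<close> survives on the right, so the sum over residues turns
  the moment matrix into a product of a lower and an upper triangular matrix; summation by parts
  does the same for the other two determinants. Hence every string satisfies the formulas for its
  masses and gaps.

  A string with given data exists by peeling off the last mass and gap: the zeros of the reduced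
  \<open>A\<close> strictly interlace with the old ones, and the relation
  \<open>C(x) A(-x) - B(x) B(-x) + A(x) C(-x) = 0\<close> keeps the residues negative.
\<close>

subsection \<open>The state vector of a string\<close>

text \<open>
  Index \<open>0\<close> is the vector \<open>(1, 0, 0)\<close> to the left of the first mass. The value \<open>l 0\<close> is immaterial,
  because a constant vector \<open>(1, 0, 0)\<close> is not affected by any gap.
\<close>

fun phi0 phi1 phi2 :: "(nat \<Rightarrow> real) \<Rightarrow> (nat \<Rightarrow> real) \<Rightarrow> nat \<Rightarrow> real poly" where
  "phi0 m l 0 = 1"
| "phi0 m l (Suc k) = phi0 m l k + smult (l k) (phi1 m l k) + smult ((l k)\<^sup>2 / 2) (phi2 m l k)"
| "phi1 m l 0 = 0"
| "phi1 m l (Suc k) = phi1 m l k + smult (l k) (phi2 m l k)"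
| "phi2 m l 0 = 0"
| "phi2 m l (Suc k) = phi2 m l k - smult (2 * m (Suc k)) (pCons 0 (phi0 m l (Suc k)))"

lemma L_mat_mult_vec:
  "L_mat l *\<^sub>v vec_of_list [u, v, w] =
     vec_of_list [u + smult l v + smult (l\<^sup>2 / 2) w, v + smult l w, w]"
  by (rule eq_vecI)
    (auto simp: L_mat_def mat_of_rows_list_def scalar_prod_def numeral_3_eq_3 less_Suc_eq
       atLeast0_lessThan_Suc)

lemma G_mat_mult_vec:
  "G_mat c *\<^sub>v vec_of_list [u, v, w] = vec_of_list [u, v, w - smult (2 * c) (pCons 0 u)]"
  by (rule eq_vecI)
    (auto simp: G_mat_def mat_of_rows_list_def scalar_prod_def numeral_3_eq_3 less_Suc_eq
       atLeast0_lessThan_Suc)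

lemma string_vec_eq:
  "string_vec x m k =
     vec_of_list [phi0 m (string_gap x) k, phi1 m (string_gap x) k, phi2 m (string_gap x) k]"
  by (induction x m k rule: string_vec.induct)
    (simp_all only: string_vec.simps L_mat_mult_vec G_mat_mult_vec, simp_all)

text \<open>Index \<open>0\<close> is left out for \<open>l\<close> because \<open>l 0\<close> only
  multiplies zero components of the initial vector. This locality lets a string be extended at its
  right end by function update.\<close>

lemma phi_cong:
  assumes "\<And>j. j \<in> {1..k} \<Longrightarrow> m j = m' j" "\<And>j. j \<in> {1..<k} \<Longrightarrow> l j = l' j"
  shows "phi0 m l k = phi0 m' l' k" "phi1 m l k = phi1 m' l' k" "phi2 m l k = phi2 m' l' k"
proof -
  have "phi0 m l k = phi0 m' l' k \<and> phi1 m l k = phi1 m' l' k \<and> phi2 m l k = phi2 m' l' k"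
    using assms
  proof (induction k)
    case (Suc k)
    then have IH: "phi0 m l k = phi0 m' l' k" "phi1 m l k = phi1 m' l' k" "phi2 m l k = phi2 m' l' k"
      by auto
    show ?case
    proof (cases "k = 0")
      case True
      with Suc.prems show ?thesis by simp
    next
      case False
      then have "l k = l' k" "m (Suc k) = m' (Suc k)" using Suc.prems by auto
      then show ?thesis by (simp add: IH)
    qed
  qed simp
  then show "phi0 m l k = phi0 m' l' k" "phi1 m l k = phi1 m' l' k" "phi2 m l k = phi2 m' l' k"
    by auto
qed

text \<open>The bilinear form on the right starts at zero and is invariant under a gap; each mass
  adds \<open>2 m_k (x + y) C_k(x) C_k(y)\<close>.\<close>

lemma christoffel_darboux:
  "(x + y) * (\<Sum>k<n. 2 * m (Suc k) * poly (phi0 m l (Suc k)) x * poly (phi0 m l (Suc k)) y) =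
     poly (phi1 m l n) x * poly (phi1 m l n) y
     - poly (phi0 m l n) x * poly (phi2 m l n) y - poly (phi2 m l n) x * poly (phi0 m l n) y"
proof (induction n)
  case (Suc n)
  have G: "poly (phi2 m l (Suc n)) z = poly (phi2 m l n) z - 2 * m (Suc n) * z * poly (phi0 m l (Suc n)) z"
    for z by (simp only: phi2.simps) (simp del: phi0.simps)
  \<comment> \<open>Invariance under the gap: the first two components are already advanced, while
    \<open>phi2\<close> changes only at the mass.\<close>
  have "poly (phi1 m l (Suc n)) x * poly (phi1 m l (Suc n)) y
      - poly (phi0 m l (Suc n)) x * poly (phi2 m l n) y
      - poly (phi2 m l n) x * poly (phi0 m l (Suc n)) y =
    poly (phi1 m l n) x * poly (phi1 m l n) y
      - poly (phi0 m l n) x * poly (phi2 m l n) y - poly (phi2 m l n) x * poly (phi0 m l n) y"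
    by (simp add: field_simps power2_eq_square)
  with Suc show ?case
    unfolding sum.lessThan_Suc G by (simp add: algebra_simps del: phi0.simps phi1.simps)
qed simp

section \<open>Constant terms, degrees and leading coefficients\<close>

lemma phi_0:
  "coeff (phi0 m l k) 0 = 1" "coeff (phi1 m l k) 0 = 0" "coeff (phi2 m l k) 0 = 0"
proof -
  have "coeff (phi0 m l k) 0 = 1 \<and> coeff (phi1 m l k) 0 = 0 \<and> coeff (phi2 m l k) 0 = 0"
    by (induction k) auto
  then show "coeff (phi0 m l k) 0 = 1" "coeff (phi1 m l k) 0 = 0" "coeff (phi2 m l k) 0 = 0"
    by auto
qed

lemma coeff_phi2_1: "coeff (phi2 m l n) 1 = - 2 * (\<Sum>k\<in>{1..n}. m k)"
proof (induction n)
  case (Suc n)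
  have "coeff (phi2 m l (Suc n)) 1 = coeff (phi2 m l n) 1 - 2 * m (Suc n)"
    using phi_0(1)[of m l "Suc n"] by (simp del: phi0.simps)
  with Suc show ?case by (simp add: algebra_simps del: phi2.simps)
qed simp

lemma degree_phi:
  "degree (phi0 m l k) \<le> k - 1" "degree (phi1 m l k) \<le> k - 1" "degree (phi2 m l k) \<le> k"
proof -
  have "degree (phi0 m l k) \<le> k - 1 \<and> degree (phi1 m l k) \<le> k - 1 \<and> degree (phi2 m l k) \<le> k"
  proof (induction k)
    case (Suc k)
    have 0: "degree (phi0 m l (Suc k)) \<le> k" "degree (phi1 m l (Suc k)) \<le> k"
      using Suc by (auto intro!: degree_add_le order.trans[OF degree_smult_le])
    have "degree (phi2 m l (Suc k)) \<le> Suc k"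
      unfolding phi2.simps using Suc 0(1)
      by (intro degree_diff_le order.trans[OF degree_smult_le]
          order.trans[OF degree_pCons_le]) auto
    with 0 show ?case by simp
  qed simp
  then show "degree (phi0 m l k) \<le> k - 1" "degree (phi1 m l k) \<le> k - 1" "degree (phi2 m l k) \<le> k"
    by auto
qed

text \<open>After \<open>k\<close> masses \<open>phi2\<close> may have degree \<open>k\<close> while
  the other components stay below, so across the gap only \<open>phi2\<close> feeds the coefficient
  of degree \<open>k\<close>. For \<open>k = 0\<close> this fails, since \<open>phi0\<close> is then
  the constant \<open>1\<close>.\<close>

lemma lead_phi:
  assumes "0 < k"
  shows "coeff (phi0 m l (Suc k)) k = (l k)\<^sup>2 / 2 * coeff (phi2 m l k) k"
    and "coeff (phi1 m l (Suc k)) k = l k * coeff (phi2 m l k) k"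
    and "coeff (phi2 m l k) k = - 2 * m k * coeff (phi0 m l k) (k - 1)"
proof -
  have *: "coeff (phi0 m l k) k = 0" "coeff (phi1 m l k) k = 0"
    using degree_phi[of m l k] assms by (auto intro!: coeff_eq_0)
  then show "coeff (phi0 m l (Suc k)) k = (l k)\<^sup>2 / 2 * coeff (phi2 m l k) k"
    "coeff (phi1 m l (Suc k)) k = l k * coeff (phi2 m l k) k" by auto
  obtain j where j: "k = Suc j" using assms by (cases k) auto
  have "coeff (phi2 m l j) k = 0"
    using degree_phi(3)[of m l j] j by (auto intro!: coeff_eq_0)
  then show "coeff (phi2 m l k) k = - 2 * m k * coeff (phi0 m l k) (k - 1)"
    by (simp add: j del: phi0.simps)
qed

lemma lead_phi_nonzero:
  assumes "\<And>j. j \<in> {1..n} \<Longrightarrow> m j \<noteq> 0" "\<And>j. j \<in> {1..<n} \<Longrightarrow> l j \<noteq> 0" "k \<in> {1..n}"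
  shows "coeff (phi2 m l k) k \<noteq> 0" "coeff (phi0 m l k) (k - 1) \<noteq> 0"
proof -
  have "k \<le> n \<Longrightarrow> 0 < k \<Longrightarrow> coeff (phi2 m l k) k \<noteq> 0 \<and> coeff (phi0 m l k) (k - 1) \<noteq> 0"
  proof (induction k)
    case (Suc k)
    have "coeff (phi0 m l (Suc k)) k \<noteq> 0"
    proof (cases "k = 0")
      case False
      then show ?thesis using Suc assms(2)[of k] by (subst lead_phi(1)) auto
    qed simp
    then show ?case
      using lead_phi(3)[of "Suc k" m l] assms(1)[of "Suc k"] Suc.prems by (simp del: phi0.simps phi2.simps)
  qed simp
  then show "coeff (phi2 m l k) k \<noteq> 0" "coeff (phi0 m l k) (k - 1) \<noteq> 0"
    using assms(3) by auto
qed

text \<open>Vanishing of \<open>P s i\<close> for \<open>s > i\<close> cuts the sum to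
  \<open>s < k\<close>, which leaves a lower times an upper triangular matrix. The separate bound
  \<open>N\<close> lets one factorisation serve all leading minors.\<close>

lemma det_triangular_factorisation:
  fixes P Q :: "nat \<Rightarrow> nat \<Rightarrow> 'a :: comm_ring_1"
  assumes "\<And>i j. i < k \<Longrightarrow> j < k \<Longrightarrow> f (i, j) = (\<Sum>s<N. P s i * Q s j)"
    and "\<And>s i. i < s \<Longrightarrow> i < k \<Longrightarrow> s < N \<Longrightarrow> P s i = 0"
    and "\<And>s i. i < s \<Longrightarrow> i < k \<Longrightarrow> s < N \<Longrightarrow> Q s i = 0"
    and "k \<le> N"
  shows "det (mat k k f) = (\<Prod>s<k. P s s * Q s s)"
proof -
  let ?P = "mat k k (\<lambda>(i, s). P s i)" and ?Q = "mat k k (\<lambda>(s, j). Q s j)"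
  have "mat k k f = ?P * ?Q"
  proof (rule eq_matI)
    fix i j assume "i < dim_row (?P * ?Q)" "j < dim_col (?P * ?Q)"
    then have ij: "i < k" "j < k" by auto
    have "f (i, j) = (\<Sum>s<N. P s i * Q s j)" using assms(1) ij by simp
    also have "\<dots> = (\<Sum>s<k. P s i * Q s j)"
      using ij assms(2,4) by (intro sum.mono_neutral_right) auto
    finally show "mat k k f $$ (i, j) = (?P * ?Q) $$ (i, j)"
      using ij by (simp add: scalar_prod_def lessThan_atLeast0)
  qed auto
  moreover have "det ?P = prod_list (diag_mat ?P)"
    by (rule det_lower_triangular[of k]) (use assms in auto)
  moreover have "det ?Q = prod_list (diag_mat ?Q)"
    by (rule det_upper_triangular[of _ k]) (use assms in \<open>auto simp: upper_triangular_def\<close>)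
  moreover have "det (?P * ?Q) = det ?P * det ?Q"
    by (rule det_mult) auto
  ultimately show ?thesis
    by (simp add: prod_list_diag_prod prod.distrib lessThan_atLeast0)
qed

subsection \<open>Interpolation at simple nodes\<close>

definition node_poly :: "real \<Rightarrow> (nat \<Rightarrow> real) \<Rightarrow> nat set \<Rightarrow> real poly" where
  "node_poly a lam S = smult a (\<Prod>q\<in>S. [:- lam q, 1:])"

text \<open>The derivative of \<open>node_poly a lam {..<n}\<close> at its zero
  \<open>lam p\<close>, in product form.\<close>

definition node_weight :: "real \<Rightarrow> (nat \<Rightarrow> real) \<Rightarrow> nat \<Rightarrow> nat \<Rightarrow> real" where
  "node_weight a lam n p = poly (node_poly a lam ({..<n} - {p})) (lam p)"

text \<open>For distinct nodes and nonzero \<open>a\<close>, the sum of the residues of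
  \<open>g / node_poly a lam {..<n}\<close>.\<close>

definition residue_sum :: "real \<Rightarrow> (nat \<Rightarrow> real) \<Rightarrow> nat \<Rightarrow> real poly \<Rightarrow> real" where
  "residue_sum a lam n g = (\<Sum>p<n. poly g (lam p) / node_weight a lam n p)"

lemma poly_node_poly: "poly (node_poly a lam S) z = a * (\<Prod>q\<in>S. z - lam q)"
  by (simp add: node_poly_def poly_prod)

lemma poly_node_poly_node: "finite S \<Longrightarrow> q \<in> S \<Longrightarrow> poly (node_poly a lam S) (lam q) = 0"
  by (auto simp: poly_node_poly)

lemma node_poly_remove:
  "finite S \<Longrightarrow> p \<in> S \<Longrightarrow> node_poly a lam S = [:- lam p, 1:] * node_poly a lam (S - {p})"
  unfolding node_poly_def by (subst prod.remove[of S p]) simp_all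

lemma degree_node_poly:
  assumes "finite S"
  shows "degree (node_poly a lam S) \<le> card S" and "coeff (node_poly a lam S) (card S) = a"
proof -
  have *: "degree (\<Prod>q\<in>S. [:- lam q, 1:]) = card S"
    using assms by (simp add: degree_prod_eq_sum_degree)
  then show "degree (node_poly a lam S) \<le> card S"
    by (simp add: node_poly_def)
  have "lead_coeff (\<Prod>q\<in>S. [:- lam q, 1:]) = 1"
    by (simp add: lead_coeff_prod)
  with * show "coeff (node_poly a lam S) (card S) = a"
    by (simp add: node_poly_def)
qed

lemma node_poly_eqI:
  assumes "inj_on lam S" "finite S" "degree g \<le> card S" "\<And>q. q \<in> S \<Longrightarrow> poly g (lam q) = 0"
  shows "g = node_poly (coeff g (card S)) lam S"
proof (rule poly_eqI_degree_lead_coeff[where A = "lam ` S" and n = "card S"])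
  fix z assume "z \<in> lam ` S"
  then show "poly g z = poly (node_poly (coeff g (card S)) lam S) z"
    using assms by (auto simp: poly_node_poly intro!: prod_zero)
qed (use assms degree_node_poly in \<open>auto simp: card_image\<close>)

lemma node_weight_nonzero:
  assumes "inj_on lam {..<n}" "a \<noteq> 0" "p < n"
  shows "node_weight a lam n p \<noteq> 0"
  using assms by (auto simp: node_weight_def poly_node_poly inj_on_def)

text \<open>The numerator of \<open>\<Sum>p<n. f p / (z - lam p)\<close> over the common denominator
  \<open>node_poly a lam {..<n}\<close>.\<close>

definition fraction_poly :: "real \<Rightarrow> (nat \<Rightarrow> real) \<Rightarrow> nat \<Rightarrow> (nat \<Rightarrow> real) \<Rightarrow> real poly" where
  "fraction_poly a lam n f = (\<Sum>p<n. smult (f p) (node_poly a lam ({..<n} - {p})))"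

lemma degree_fraction_poly: "0 < n \<Longrightarrow> degree (fraction_poly a lam n f) < n"
proof -
  assume n: "0 < n"
  have "degree (fraction_poly a lam n f) \<le> n - 1"
    unfolding fraction_poly_def
  proof (rule degree_sum_le)
    fix p assume "p \<in> {..<n}"
    then show "degree (smult (f p) (node_poly a lam ({..<n} - {p}))) \<le> n - 1"
      using degree_node_poly(1)[of "{..<n} - {p}" a lam]
      by (intro order.trans[OF degree_smult_le]) simp
  qed simp
  with n show ?thesis by simp
qed

lemma poly_fraction_poly_node:
  assumes "q < n"
  shows "poly (fraction_poly a lam n f) (lam q) = f q * node_weight a lam n q"
proof -
  have "poly (node_poly a lam ({..<n} - {p})) (lam q) = (if p = q then node_weight a lam n q else 0)"
    for p
    using assms by (auto simp: node_weight_def poly_node_poly)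
  then have "poly (fraction_poly a lam n f) (lam q) =
      (\<Sum>p<n. if p = q then f p * node_weight a lam n q else 0)"
    unfolding fraction_poly_def poly_sum poly_smult by (intro sum.cong) auto
  also have "\<dots> = f q * node_weight a lam n q" using assms by simp
  finally show ?thesis .
qed

lemma poly_fraction_poly:
  assumes "\<And>p. p < n \<Longrightarrow> z \<noteq> lam p"
  shows "poly (fraction_poly a lam n f) z =
    poly (node_poly a lam {..<n}) z * (\<Sum>p<n. f p / (z - lam p))"
  unfolding fraction_poly_def poly_sum sum_distrib_left
proof (intro sum.cong refl)
  fix p assume p: "p \<in> {..<n}"
  have "poly (node_poly a lam {..<n}) z = (z - lam p) * poly (node_poly a lam ({..<n} - {p})) z"
    using p by (subst node_poly_remove[of _ p]) (simp_all add: algebra_simps)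
  then show "poly (smult (f p) (node_poly a lam ({..<n} - {p}))) z =
    poly (node_poly a lam {..<n}) z * (f p / (z - lam p))"
    using assms[of p] p by simp
qed

lemma lagrange_interpolation:
  assumes "inj_on lam {..<n}" "a \<noteq> 0" "degree g < n"
  shows "g = fraction_poly a lam n (\<lambda>p. poly g (lam p) / node_weight a lam n p)"
proof (rule poly_eqI_degree[where A = "lam ` {..<n}"])
  have card: "card (lam ` {..<n}) = n" using assms by (simp add: card_image)
  then show "degree g < card (lam ` {..<n})" using assms by simp
  show "degree (fraction_poly a lam n (\<lambda>p. poly g (lam p) / node_weight a lam n p)) < card (lam ` {..<n})"
    unfolding card using assms by (intro degree_fraction_poly) auto
qed (use assms node_weight_nonzero[OF assms(1,2)] in \<open>auto simp: poly_fraction_poly_node\<close>)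

lemma coeff_fraction_poly: "coeff (fraction_poly a lam n f) (n - 1) = a * (\<Sum>p<n. f p)"
  unfolding fraction_poly_def coeff_sum sum_distrib_left
proof (intro sum.cong refl)
  fix p assume "p \<in> {..<n}"
  then show "coeff (smult (f p) (node_poly a lam ({..<n} - {p}))) (n - 1) = a * f p"
    using degree_node_poly(2)[of "{..<n} - {p}" a lam] by simp
qed

text \<open>Each summand of the Lagrange formula has top coefficient \<open>a\<close> times its
  residue; this is the residue at infinity.\<close>

lemma residue_sum_eq_coeff:
  assumes "inj_on lam {..<n}" "a \<noteq> 0" "degree g < n"
  shows "residue_sum a lam n g = coeff g (n - 1) / a"
proof -
  have "coeff g (n - 1) = a * residue_sum a lam n g"
    by (subst (1) lagrange_interpolation[OF assms]) (simp only: coeff_fraction_poly residue_sum_def)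
  then show ?thesis using assms by simp
qed

lemma node_weight_0:
  assumes "lam 0 = 0" "0 < n"
  shows "coeff (node_poly a lam {..<n}) 1 = node_weight a lam n 0"
  unfolding node_weight_def using node_poly_remove[of "{..<n}" 0 a lam] assms
  by (simp add: poly_0_coeff_0)

lemma residue_sum_linear:
  "residue_sum a lam n (g + h) = residue_sum a lam n g + residue_sum a lam n h"
  "residue_sum a lam n (g - h) = residue_sum a lam n g - residue_sum a lam n h"
  "residue_sum a lam n (smult c g) = c * residue_sum a lam n g"
  "residue_sum a lam n 0 = 0"
  by (simp_all add: residue_sum_def add_divide_distrib diff_divide_distrib sum.distrib sum_subtractf
      sum_distrib_left)

text \<open>Below the critical degree \<open>n - 1\<close> the residues cancel. This vanishing
  produces the triangular factors in the determinant evaluations.\<close>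

lemma residue_sum_monom_mult:
  assumes "inj_on lam {..<n}" "a \<noteq> 0" "degree g \<le> d" "i + d < n"
  shows "residue_sum a lam n (monom 1 i * g) = (if Suc (i + d) = n then coeff g d / a else 0)"
proof -
  have deg: "degree (monom 1 i * g) \<le> i + d"
    using degree_mult_le[of "monom 1 i :: real poly" g] degree_monom_le[of "1::real" i] assms(3)
    by linarith
  then have "residue_sum a lam n (monom 1 i * g) = coeff (monom 1 i * g) (n - 1) / a"
    using assms by (intro residue_sum_eq_coeff) auto
  moreover have "coeff (monom 1 i * g) (n - 1) = (if Suc (i + d) = n then coeff g d else 0)"
  proof (cases "Suc (i + d) = n")
    case True
    then have "n - 1 = d + i" by simp
    then show ?thesis using True by (simp add: coeff_monom_mult)
  next
    case False
    then have "i + d < n - 1" using assms(4) by linarith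
    then show ?thesis using deg False by (auto intro!: coeff_eq_0)
  qed
  ultimately show ?thesis by simp
qed

lemma residue_sum_node_poly:
  "residue_sum a lam n (h * node_poly a lam {..<n}) = 0"
  unfolding residue_sum_def
  by (intro sum.neutral) (auto simp: poly_node_poly)

subsection \<open>The determinants of the spectral data of a string\<close>

lemma sum_by_parts:
  fixes f g :: "nat \<Rightarrow> 'a :: comm_ring"
  shows "(\<Sum>k<N. (f (Suc k) - f k) * g k) =
    (\<Sum>k<N. f (Suc k) * (g k - g (Suc k))) + f N * g N - f 0 * g 0"
  by (induction N) (simp_all add: algebra_simps)

lemma sum_rev_lessThan: "(\<Sum>k<n. f k) = (\<Sum>s<n. f (n - Suc s))"
  by (rule sum.nat_diff_reindex[symmetric])

text \<open>The zero of \<open>A\<close> at the origin occupies index \<open>0\<close>, so all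
  \<open>n\<close> zeros serve as interpolation nodes and the positive ones keep the indices
  \<open>{1..<n}\<close>.\<close>

locale spectral_string =
  fixes n :: nat and m l lam b :: "nat \<Rightarrow> real" and a :: real
  assumes n_pos: "0 < n"
    and m_pos: "\<And>k. k \<in> {1..n} \<Longrightarrow> 0 < m k"
    and l_pos: "\<And>k. k \<in> {1..<n} \<Longrightarrow> 0 < l k"
    and lam_0: "lam 0 = 0"
    and lam_mono: "strict_mono_on {..<n} lam"
    and phi2_eq: "phi2 m l n = node_poly a lam {..<n}"
    and b_eq: "\<And>p. p \<in> {1..<n} \<Longrightarrow> b p = poly (phi1 m l n) (lam p) / node_weight a lam n p"
begin

abbreviation "C \<equiv> phi0 m l"
abbreviation "B \<equiv> phi1 m l"
abbreviation "A \<equiv> phi2 m l"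
abbreviation "w \<equiv> node_weight a lam n"
abbreviation "res i g \<equiv> residue_sum a lam n (monom 1 i * g)"

definition "M = (\<Sum>k\<in>{1..n}. m k)"
text \<open>Leading coefficients relative to that of \<open>A n\<close>; the determinants become
  products of these with masses and gaps.\<close>

definition "c k = coeff (C k) (k - 1) / a"
definition "r k = coeff (A k) k / a"

lemma lam_inj: "inj_on lam {..<n}"
  using lam_mono by (rule strict_mono_on_imp_inj_on)

lemma lam_pos: "0 < p \<Longrightarrow> p < n \<Longrightarrow> 0 < lam p"
  using lam_mono lam_0 n_pos by (metis lessThan_iff strict_mono_onD)

lemma a_eq: "a = coeff (A n) n"
  unfolding phi2_eq using degree_node_poly(2)[of "{..<n}" a lam] by simp

lemma lead_nonzero:
  assumes "k \<in> {1..n}"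
  shows "coeff (A k) k \<noteq> 0" "coeff (C k) (k - 1) \<noteq> 0"
  using assms m_pos l_pos by (intro lead_phi_nonzero[of n]; force)+

lemma a_nonzero: "a \<noteq> 0"
  using lead_nonzero(1)[of n] n_pos by (simp add: a_eq)

lemma c_nonzero: "k \<in> {1..n} \<Longrightarrow> c k \<noteq> 0"
  using lead_nonzero(2) a_nonzero by (simp add: c_def)

lemma r_nonzero: "k \<in> {1..n} \<Longrightarrow> r k \<noteq> 0"
  using lead_nonzero(1) a_nonzero by (simp add: r_def)

lemma r_n: "r n = 1"
  using a_nonzero by (simp add: r_def flip: a_eq)

lemma r_eq: "0 < k \<Longrightarrow> r k = - 2 * m k * c k"
  using lead_phi(3)[of k m l] by (simp add: r_def c_def)

lemma c_Suc: "0 < k \<Longrightarrow> c (Suc k) = (l k)\<^sup>2 / 2 * r k"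
  by (simp only: r_def c_def diff_Suc_1 lead_phi(1) times_divide_eq_right)

text \<open>The slope of \<open>A n\<close> at the origin. It is the source of the extra
  \<open>1 / (2 * M)\<close> in the first entry of the moment matrix.\<close>

lemma w_0: "w 0 = - 2 * M"
proof -
  have "w 0 = coeff (A n) 1"
    unfolding phi2_eq using node_weight_0[of lam n a] lam_0 n_pos by simp
  then show ?thesis by (simp only: coeff_phi2_1 M_def)
qed

lemma res_def: "res i g = (\<Sum>p<n. lam p ^ i * poly g (lam p) / w p)"
  by (simp add: residue_sum_def poly_monom)

lemma res_eq:
  assumes "degree g \<le> d" "i + d < n"
  shows "res i g = (if Suc (i + d) = n then coeff g d / a else 0)"
  using residue_sum_monom_mult[OF lam_inj a_nonzero assms] .

lemma lessThan_n: "{..<n} = insert 0 {1..<n}"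
  using n_pos by auto

lemma poly_B_0: "poly (B n) 0 = 0"
  by (simp add: poly_0_coeff_0 phi_0)

lemma beta_eq: "beta n lam b i = res i (B n)"
  by (simp add: res_def lessThan_n lam_0 poly_B_0 beta_def b_eq mult.commute)

text \<open>The residue sum is applied in both variables to the Christoffel--Darboux kernel. At two
  positive zeros of \<open>A n\<close> the kernel is \<open>B(x) B(y) / (x + y)\<close>, whose
  weighted sum is the double moment.\<close>

lemma I_moment_eq:
  "I_moment n lam b i j + (if i = 0 \<and> j = 0 then 1 / (2 * M) else 0) =
     (\<Sum>k<n. 2 * m (Suc k) * res i (C (Suc k)) * res j (C (Suc k)))"
proof -
  define K where "K x y = (\<Sum>k<n. 2 * m (Suc k) * poly (C (Suc k)) x * poly (C (Suc k)) y)" for x y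
  define T where "T p q = lam p ^ i * lam q ^ j * K (lam p) (lam q) / (w p * w q)" for p q
  have M: "M > 0" unfolding M_def using m_pos n_pos by (intro sum_pos) auto
  have CD: "(lam p + lam q) * K (lam p) (lam q) = poly (B n) (lam p) * poly (B n) (lam q)"
    if "p < n" "q < n" for p q
  proof -
    have "poly (A n) (lam p) = 0" "poly (A n) (lam q) = 0"
      using that by (auto simp: phi2_eq poly_node_poly)
    then show ?thesis unfolding K_def christoffel_darboux by simp
  qed
  \<comment> \<open>If exactly one node is the origin, \<open>B(0) = 0\<close> makes the kernel
    vanish.\<close>
  have T1: "T p 0 = 0" "T 0 p = 0" if "p \<in> {1..<n}" for p
    using CD[of p 0] CD[of 0 p] that lam_pos[of p] n_pos by (auto simp: T_def lam_0 poly_B_0)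
  have T2: "T p q = lam p ^ i * lam q ^ j / (lam p + lam q) * b p * b q"
    if "p \<in> {1..<n}" "q \<in> {1..<n}" for p q
  proof -
    have "K (lam p) (lam q) = poly (B n) (lam p) * poly (B n) (lam q) / (lam p + lam q)"
      using CD[of p q] that lam_pos[of p] lam_pos[of q] by (auto simp: field_simps)
    then show ?thesis using that by (simp add: T_def b_eq)
  qed
  \<comment> \<open>At the pair of origins \<open>x + y = 0\<close> gives no information, so the
    kernel is evaluated directly: \<open>C_k(0) = 1\<close> yields \<open>2 * M\<close>, and
    division by \<open>(w 0)^2\<close> leaves \<open>1 / (2 * M)\<close>.\<close>
  have "(\<Sum>k<n. m (Suc k)) = M"
    by (simp add: M_def sum.atLeast1_atMost_eq)
  then have "K 0 0 = 2 * M"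
    by (simp add: K_def poly_0_coeff_0 phi_0 flip: sum_distrib_left del: phi0.simps)
  then have T3: "T 0 0 = (if i = 0 \<and> j = 0 then 1 / (2 * M) else 0)"
    using M by (auto simp: T_def lam_0 w_0)
  have "(\<Sum>k<n. 2 * m (Suc k) * res i (C (Suc k)) * res j (C (Suc k))) =
    (\<Sum>k<n. \<Sum>p<n. \<Sum>q<n. 2 * m (Suc k) * (lam p ^ i * poly (C (Suc k)) (lam p) / w p) *
      (lam q ^ j * poly (C (Suc k)) (lam q) / w q))"
    by (simp only: res_def mult.assoc sum_product) (simp only: sum_distrib_left mult.assoc)
  also have "\<dots> = (\<Sum>p<n. \<Sum>q<n. \<Sum>k<n. 2 * m (Suc k) * (lam p ^ i * poly (C (Suc k)) (lam p) / w p) *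
      (lam q ^ j * poly (C (Suc k)) (lam q) / w q))"
    by (subst sum.swap, rule sum.cong[OF refl], rule sum.swap)
  also have "\<dots> = (\<Sum>p<n. \<Sum>q<n. T p q)"
    unfolding T_def K_def sum_distrib_left sum_divide_distrib
    by (intro sum.cong refl) (simp add: field_simps del: phi0.simps)
  also have "\<dots> = T 0 0 + (\<Sum>p\<in>{1..<n}. \<Sum>q\<in>{1..<n}. T p q)"
    by (simp add: lessThan_n T1)
  also have "\<dots> = I_moment n lam b i j + (if i = 0 \<and> j = 0 then 1 / (2 * M) else 0)"
    by (simp add: T3 T2 I_moment_def)
  finally show ?thesis by simp
qed

text \<open>With masses counted from the right by \<open>s\<close>, \<open>C (n - s)\<close> has
  degree at most \<open>n - s - 1\<close>, so \<open>res i\<close> of it is zero for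
  \<open>i < s\<close> and \<open>c (n - s)\<close> for \<open>i = s\<close>.\<close>

lemma A_det_eq:
  assumes "k \<le> n"
  shows "A_det n lam b M k = (\<Prod>s<k. 2 * m (n - s) * (c (n - s))\<^sup>2)"
proof -
  have van: "res i (C (n - s)) = (if s = i then c (n - s) else 0)" if "i \<le> s" "s < n" for i s
    using res_eq[OF degree_phi(1)[of m l "n - s"], of i] that by (auto simp: c_def)
  have "A_det n lam b M k =
    (\<Prod>s<k. (2 * m (n - s) * res s (C (n - s))) * res s (C (n - s)))"
    unfolding A_det_def
  proof (rule det_triangular_factorisation[where N = n and
        P = "\<lambda>s i. 2 * m (n - s) * res i (C (n - s))" and Q = "\<lambda>s j. res j (C (n - s))"])
    fix i j
    have "(\<Sum>k<n. 2 * m (Suc k) * res i (C (Suc k)) * res j (C (Suc k))) =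
      (\<Sum>s<n. 2 * m (n - s) * res i (C (n - s)) * res j (C (n - s)))"
      by (subst sum_rev_lessThan) (intro sum.cong refl, simp del: phi0.simps add: Suc_diff_Suc)
    then show "(case (i, j) of (i, j) \<Rightarrow> if i = 0 \<and> j = 0 then I_moment n lam b 0 0 + 1 / (2 * M)
        else I_moment n lam b i j) =
      (\<Sum>s<n. 2 * m (n - s) * res i (C (n - s)) * res j (C (n - s)))"
      using I_moment_eq[of i j] by auto
  qed (use van assms in auto)
  also have "\<dots> = (\<Prod>s<k. 2 * m (n - s) * (c (n - s))\<^sup>2)"
    using assms by (intro prod.cong) (auto simp: van power2_eq_square)
  finally show ?thesis .
qed

text \<open>By the mass relation \<open>2 m_(k+1) x C_(k+1) = A_k - A_(k+1)\<close>, summation by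
  parts moves the difference onto \<open>C\<close>. The boundary terms vanish since
  \<open>A n\<close> is zero at the nodes and \<open>A 0 = 0\<close>.\<close>

lemma I_moment_Suc_eq:
  "I_moment n lam b (Suc i) j = (\<Sum>k<n. res i (A k) * res j (C (Suc k) - C k))"
proof -
  let ?f = "\<lambda>k. res i (A k)" and ?g = "\<lambda>k. res j (C k)"
  have *: "2 * m (Suc k) * res (Suc i) (C (Suc k)) = ?f k - ?f (Suc k)" for k
  proof -
    have "monom 1 i * A k - monom 1 i * A (Suc k) =
      smult (2 * m (Suc k)) (monom 1 (Suc i) * C (Suc k))"
      by (simp only: phi2.simps) (simp add: monom_Suc algebra_simps del: phi0.simps)
    then show ?thesis by (simp only: flip: residue_sum_linear)
  qed
  have "I_moment n lam b (Suc i) j = (\<Sum>k<n. (?f k - ?f (Suc k)) * ?g (Suc k))"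
    using I_moment_eq[of "Suc i" j] by (simp only: *) simp
  also have "\<dots> = (\<Sum>k<n. ?f k * (?g (Suc k) - ?g k)) - ?f n * ?g n + ?f 0 * ?g 0"
    using sum_by_parts[of ?g ?f n] by (simp add: mult.commute del: phi0.simps phi2.simps)
  also have "?f n = 0"
    by (simp only: phi2_eq residue_sum_node_poly)
  also have "?f 0 = 0"
    by (simp add: residue_sum_linear)
  finally show ?thesis
    by (simp add: right_diff_distrib residue_sum_linear del: phi0.simps)
qed

lemma res_A: "res i (A (n - Suc s)) = (if s = i then r (n - Suc s) else 0)" if "i \<le> s" "s < n"
  using res_eq[OF degree_phi(3)[of m l "n - Suc s"], of i] that by (auto simp: r_def)

lemma D_det_eq:
  assumes "k < n"
  shows "D_det n lam b k = (\<Prod>s<k. r (n - Suc s) * c (n - s))"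
proof -
  \<comment> \<open>The case \<open>s = n - 1\<close> is excluded: there
    \<open>C 1 - C 0 = 0\<close>, although \<open>c 1\<close> is nonzero.\<close>
  have van: "res i (C (n - s) - C (n - Suc s)) = (if s = i then c (n - s) else 0)"
    if "i \<le> s" "Suc s < n" for i s
  proof -
    have "degree (C (n - s) - C (n - Suc s)) \<le> n - Suc s"
      using degree_phi(1)[of m l "n - s"] degree_phi(1)[of m l "n - Suc s"] that
      by (intro degree_diff_le) auto
    moreover have "coeff (C (n - Suc s)) (n - Suc s) = 0"
      using degree_phi(1)[of m l "n - Suc s"] that by (intro coeff_eq_0) auto
    ultimately show ?thesis
      using res_eq[of _ "n - Suc s" i] that by (auto simp: c_def)
  qed
  have "D_det n lam b k =
    (\<Prod>s<k. res s (A (n - Suc s)) * res s (C (n - s) - C (n - Suc s)))"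
    unfolding D_det_def
  proof (rule det_triangular_factorisation[where N = k and
        P = "\<lambda>s i. res i (A (n - Suc s))" and Q = "\<lambda>s j. res j (C (n - s) - C (n - Suc s))"])
    fix i j assume ij: "i < k" "j < k"
    have "I_moment n lam b (i + 1) j =
      (\<Sum>s<n. res i (A (n - Suc s)) * res j (C (n - s) - C (n - Suc s)))"
      by (simp only: I_moment_Suc_eq Suc_eq_plus1[symmetric], subst sum_rev_lessThan)
        (intro sum.cong refl, simp del: phi0.simps add: Suc_diff_Suc)
    also have "\<dots> = (\<Sum>s<k. res i (A (n - Suc s)) * res j (C (n - s) - C (n - Suc s)))"
      using ij assms by (intro sum.mono_neutral_right) (auto simp: res_A)
    finally show "(case (i, j) of (i, j) \<Rightarrow> I_moment n lam b (i + 1) j) =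
      (\<Sum>s<k. res i (A (n - Suc s)) * res j (C (n - s) - C (n - Suc s)))"
      by simp
  qed (use van res_A assms in auto)
  also have "\<dots> = (\<Prod>s<k. r (n - Suc s) * c (n - s))"
    using assms by (intro prod.cong) (auto simp: van res_A)
  finally show ?thesis .
qed

text \<open>The value \<open>0\<close> for \<open>n \<le> k\<close> removes the boundary term of the summation by parts.\<close>

definition "u k j = (if n \<le> k then 0 else if j = 0 then 1 else res (j - 1) (B k + smult (l k / 2) (A k)))"

text \<open>The gap relations \<open>B_(k+1) - B_k = l_k A_k\<close> and
  \<open>C_(k+1) - C_k = l_k (B_k + l_k A_k / 2)\<close> give both kinds of columns one form:
  increments of \<open>res i (B k)\<close> against \<open>u k j\<close>. Summation by parts then
  shifts the increment to \<open>u\<close>.\<close>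

lemma D'_entry:
  "(if j = 0 then beta n lam b i else I_moment n lam b (i + 1) (j - 1)) =
     (\<Sum>s<n. res i (B (n - s)) * (u (n - Suc s) j - u (n - s) j))"
proof -
  have "(if j = 0 then beta n lam b i else I_moment n lam b (i + 1) (j - 1)) =
     (\<Sum>k<n. (res i (B (Suc k)) - res i (B k)) * u k j)"
  proof (cases "j = 0")
    case True
    have "(\<Sum>k<n. res i (B (Suc k)) - res i (B k)) = res i (B n)"
      by (subst sum_lessThan_telescope) (simp add: residue_sum_linear)
    with True show ?thesis by (simp add: u_def beta_eq del: phi1.simps)
  next
    case False
    have "C (Suc k) - C k = smult (l k) (B k + smult (l k / 2) (A k))" for k
      by (simp add: smult_add_right power2_eq_square)
    moreover have "res i (B (Suc k)) - res i (B k) = l k * res i (A k)" for k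
      by (simp add: residue_sum_linear algebra_simps)
    ultimately show ?thesis using False
      by (simp add: u_def I_moment_Suc_eq residue_sum_linear algebra_simps del: phi0.simps phi1.simps)
  qed
  also have "\<dots> = (\<Sum>k<n. res i (B (Suc k)) * (u k j - u (Suc k) j))"
    by (subst sum_by_parts) (simp add: u_def residue_sum_linear del: phi1.simps(2))
  also have "\<dots> = (\<Sum>s<n. res i (B (n - s)) * (u (n - Suc s) j - u (n - s) j))"
    by (subst sum_rev_lessThan) (intro sum.cong refl, simp del: phi1.simps add: Suc_diff_Suc)
  finally show ?thesis .
qed

lemma D'_det_eq:
  assumes "k < n"
  shows "D'_det n lam b k =
    (\<Prod>s<k. l (n - Suc s) * r (n - Suc s) * (if s = 0 then 1 else - l (n - s) * r (n - s) / 2))"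
proof -
  have B: "res i (B (n - s)) = (if s = i then l (n - Suc s) * r (n - Suc s) else 0)"
    if "i \<le> s" "Suc s < n" for i s
  proof -
    have "coeff (B (n - s)) (n - Suc s) = l (n - Suc s) * coeff (A (n - Suc s)) (n - Suc s)"
      using lead_phi(2)[of "n - Suc s" m l] that by (simp add: Suc_diff_Suc del: phi1.simps)
    then show ?thesis
      using res_eq[OF degree_phi(2)[of m l "n - s"], of i] that by (auto simp: r_def)
  qed
  \<comment> \<open>In column \<open>0\<close> the increment of \<open>u\<close> is \<open>1\<close>
    exactly at \<open>s = 0\<close>, by the cutoff at \<open>n\<close>. In the other columns the
    diagonal value comes from the subtracted term \<open>u (n - s) j\<close>, hence the minus
    sign.\<close>
  have u: "u (n - Suc s) j - u (n - s) j =
      (if s = j then if s = 0 then 1 else - l (n - s) * r (n - s) / 2 else 0)"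
    if "j \<le> s" "Suc s < n" for s j
  proof (cases "j = 0")
    case True
    then show ?thesis using that by (auto simp: u_def)
  next
    case False
    have deg: "degree (B k + smult (l k / 2) (A k)) \<le> k" for k
      using degree_phi[of m l k] by (intro degree_add_le order.trans[OF degree_smult_le]) auto
    have "coeff (B (n - s)) (n - s) = 0"
      using degree_phi(2)[of m l "n - s"] that by (intro coeff_eq_0) auto
    then have "u (n - s) j = (if s = j then l (n - s) * r (n - s) / 2 else 0)"
      using False that res_eq[OF deg[of "n - s"], of "j - 1"] by (auto simp: u_def r_def)
    moreover have "u (n - Suc s) j = 0"
      using False that res_eq[OF deg[of "n - Suc s"], of "j - 1"] by (auto simp: u_def)
    ultimately show ?thesis using False by auto
  qed
  have "D'_det n lam b k =
    (\<Prod>s<k. res s (B (n - s)) * (u (n - Suc s) s - u (n - s) s))"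
    unfolding D'_det_def
  proof (rule det_triangular_factorisation[where N = k and
        P = "\<lambda>s i. res i (B (n - s))" and Q = "\<lambda>s j. u (n - Suc s) j - u (n - s) j"])
    fix i j assume ij: "i < k" "j < k"
    have "res i (B (n - s)) = 0" if "s < n" "k \<le> s" for s
      using that ij B[of i s] res_eq[OF degree_phi(2)[of m l "n - s"], of i] by auto
    then have "(\<Sum>s<n. res i (B (n - s)) * (u (n - Suc s) j - u (n - s) j)) =
      (\<Sum>s<k. res i (B (n - s)) * (u (n - Suc s) j - u (n - s) j))"
      using assms by (intro sum.mono_neutral_right) auto
    then show "(case (i, j) of (i, j) \<Rightarrow>
        if j = 0 then beta n lam b i else I_moment n lam b (i + 1) (j - 1)) =
      (\<Sum>s<k. res i (B (n - s)) * (u (n - Suc s) j - u (n - s) j))"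
      using D'_entry[of j i] by simp
  qed (use B u assms in auto)
  also have "\<dots> = (\<Prod>s<k. l (n - Suc s) * r (n - Suc s) *
      (if s = 0 then 1 else - l (n - s) * r (n - s) / 2))"
    using assms by (intro prod.cong refl) (simp add: B u)
  finally show ?thesis .
qed

section \<open>Masses and gaps recovered from the determinants\<close>

lemma A_det_pos: "k \<le> n \<Longrightarrow> 0 < A_det n lam b M k"
  using m_pos c_nonzero by (auto simp: A_det_eq intro!: prod_pos)

lemma D'_det_nonzero: "k < n \<Longrightarrow> D'_det n lam b k \<noteq> 0"
proof -
  assume k: "k < n"
  have "l j \<noteq> 0 \<and> r j \<noteq> 0" if "0 < j" "j < n" for j
    using l_pos[of j] r_nonzero[of j] that by auto
  then show ?thesis using k by (auto simp: D'_det_eq)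
qed

text \<open>By \<open>r_eq\<close> each factor of \<open>A_det\<close> is
  \<open>- r (n - s) * c (n - s)\<close>, so up to sign the quotient telescopes to
  \<open>r (n - k) / r n\<close>, and \<open>r n = 1\<close>.\<close>

lemma D_det_over_A_det: "k < n \<Longrightarrow> D_det n lam b k = (-1) ^ k * r (n - k) * A_det n lam b M k"
proof (induction k)
  case (Suc k)
  then show ?case
    using r_eq[of "n - k"] by (simp add: D_det_eq A_det_eq power2_eq_square)
qed (simp add: r_n)

text \<open>From \<open>k\<close> to \<open>k + 1\<close> the value of \<open>A_det\<close> grows by
  the factor \<open>2 m c^2\<close>, and the squared quotient of \<open>D_det\<close> by
  \<open>A_det\<close> is \<open>r^2 = 4 m^2 c^2\<close>.\<close>

theorem mass_formula:
  assumes "k < n"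
  shows "m (n - k) = (D_det n lam b k)\<^sup>2 / (2 * A_det n lam b M (k + 1) * A_det n lam b M k)"
proof -
  have A: "A_det n lam b M (k + 1) = A_det n lam b M k * (2 * m (n - k) * (c (n - k))\<^sup>2)"
    using assms by (simp add: A_det_eq)
  have "n - k \<in> {1..n}" using assms by auto
  then have "A_det n lam b M k \<noteq> 0" "c (n - k) \<noteq> 0" "m (n - k) \<noteq> 0"
    using A_det_pos[of k] c_nonzero[of "n - k"] m_pos[of "n - k"] assms by auto
  then show ?thesis using assms r_eq[of "n - k"]
    unfolding A D_det_over_A_det[OF assms]
    by (simp add: power2_eq_square field_simps flip: power_add mult_2)
qed

text \<open>Stated without division so that the induction can substitute the previous ratio;
  \<open>c_Suc\<close> brings in the new gap.\<close>

lemma A_det_over_D'_det: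
  "0 < k \<Longrightarrow> k < n \<Longrightarrow> 2 * A_det n lam b M k = - l (n - k) * D'_det n lam b k"
proof (induction k)
  case (Suc k)
  have c: "c (n - k) = (l (n - Suc k))\<^sup>2 / 2 * r (n - Suc k)"
    using c_Suc[of "n - Suc k"] Suc.prems by (simp add: Suc_diff_Suc)
  have A: "A_det n lam b M (Suc k) = - A_det n lam b M k * r (n - k) * c (n - k)"
    using Suc.prems r_eq[of "n - k"] by (simp add: A_det_eq power2_eq_square)
  show ?case
  proof (cases "k = 0")
    case True
    then show ?thesis using c Suc.prems unfolding A
      by (simp add: D'_det_eq r_n power2_eq_square)
  next
    case False
    have "D'_det n lam b (Suc k) =
      D'_det n lam b k * (l (n - Suc k) * r (n - Suc k) * (- l (n - k) * r (n - k) / 2))"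
      using False Suc.prems by (simp add: D'_det_eq)
    also have "\<dots> = (- l (n - k) * D'_det n lam b k) * l (n - Suc k) * r (n - Suc k) * r (n - k) / 2"
      by simp
    also have "- l (n - k) * D'_det n lam b k = 2 * A_det n lam b M k"
      using Suc False by simp
    finally show ?thesis unfolding A c by (simp add: power2_eq_square)
  qed
qed simp

theorem gap_formula:
  assumes "0 < k" "k < n"
  shows "l (n - k) = - (2 * A_det n lam b M k / D'_det n lam b k)"
  using A_det_over_D'_det[OF assms] D'_det_nonzero[OF assms(2)] by (simp add: field_simps)

end

subsection \<open>Existence of a string with given spectral data\<close>

text \<open>The properties that peeling preserves. Negativity of
  \<open>node_weight a lam n 0\<close> encodes positive total mass, the functional equation is the
  Christoffel--Darboux identity at \<open>y = - x\<close>, and the last conjunct makes the residues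
  of \<open>B / A\<close> negative.\<close>

definition spectral_polys ::
  "nat \<Rightarrow> real \<Rightarrow> (nat \<Rightarrow> real) \<Rightarrow> real poly \<Rightarrow> real poly \<Rightarrow> real poly \<Rightarrow> bool" where
  "spectral_polys n a lam C B A \<longleftrightarrow>
     lam 0 = 0 \<and> strict_mono_on {..<n} lam \<and> node_weight a lam n 0 < 0 \<and>
     A = node_poly a lam {..<n} \<and> degree B < n \<and> degree C < n \<and> poly B 0 = 0 \<and> poly C 0 = 1 \<and>
     (\<forall>x. poly C x * poly A (- x) - poly B x * poly B (- x) + poly A x * poly C (- x) = 0) \<and>
     (\<forall>p\<in>{1..<n}. poly B (lam p) / node_weight a lam n p < 0)"

section \<open>Signs of a polynomial with simple nonnegative zeros\<close>

lemma strict_mono_on_lessThan_pos: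
  fixes lam :: "nat \<Rightarrow> real"
  assumes "lam 0 = 0" "strict_mono_on {..<n} lam" "0 < p" "p < n"
  shows "0 < lam p"
  using strict_mono_onD[OF assms(2), of 0 p] assms by simp

lemma node_weight_0_eq: "lam 0 = 0 \<Longrightarrow> node_weight a lam n 0 = a * (\<Prod>q\<in>{1..<n}. - lam q)"
  unfolding node_weight_def poly_node_poly
  by (rule arg_cong[where f = "(*) a"], rule prod.cong) auto

text \<open>All zeros are nonnegative, so the sign on the negative axis is opposite to the slope at
  the origin. Multiplying by that slope makes the unknown sign of \<open>a\<close> enter
  squared.\<close>

lemma node_poly_pos_on_negative_axis:
  assumes "lam 0 = 0" "strict_mono_on {..<n} lam" "node_weight a lam n 0 < 0" "0 < n" "0 < x"
  shows "0 < poly (node_poly a lam {..<n}) (- x)"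
proof -
  have a: "a \<noteq> 0" using assms(1,3) by (auto simp: node_weight_0_eq)
  let ?P = "\<Prod>q\<in>{1..<n}. lam q * (x + lam q)"
  have "0 < ?P"
    using strict_mono_on_lessThan_pos[OF assms(1,2)] assms(5)
    by (intro prod_pos ballI mult_pos_pos add_pos_pos) auto
  then have "0 < a\<^sup>2 * x * ?P"
    using a assms(5) by (intro mult_pos_pos) auto
  moreover have "(\<Prod>q\<in>{1..<n}. - lam q) * (\<Prod>q\<in>{1..<n}. - x - lam q) = ?P"
    unfolding prod.distrib[symmetric] by (rule prod.cong) (simp_all add: algebra_simps)
  then have "node_weight a lam n 0 * (a * (- x * (\<Prod>q\<in>{1..<n}. - x - lam q))) = - (a\<^sup>2 * x * ?P)"
    using assms(1) by (simp add: node_weight_0_eq power2_eq_square mult.assoc mult.left_commute)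
  moreover have "{..<n} = insert 0 {1..<n}" using assms(4) by auto
  then have "poly (node_poly a lam {..<n}) (- x) = a * (- x * (\<Prod>q\<in>{1..<n}. - x - lam q))"
    using assms(1) by (simp add: poly_node_poly)
  ultimately have "node_weight a lam n 0 * poly (node_poly a lam {..<n}) (- x) < 0"
    by (simp only: neg_less_0_iff_less)
  then show ?thesis using assms(3) by (simp add: mult_less_0_iff)
qed

text \<open>Every other node lies on the same side of both \<open>lam p\<close> and
  \<open>lam (Suc p)\<close>; only the factor joining these two differs in sign.\<close>

lemma node_weight_alternates:
  assumes "strict_mono_on {..<n} lam" "a \<noteq> 0" "Suc p < n"
  shows "node_weight a lam n p * node_weight a lam n (Suc p) < 0"
proof -
  define S where "S = {..<n} - {p, Suc p}"
  have less: "lam i < lam j \<longleftrightarrow> i < j" if "i < n" "j < n" for i j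
    using strict_mono_on_less[OF assms(1)] that by auto
  have "{..<n} - {p} = insert (Suc p) S" "{..<n} - {Suc p} = insert p S"
    "finite S" "p \<notin> S" "Suc p \<notin> S"
    using assms(3) by (auto simp: S_def)
  then have "node_weight a lam n p = a * ((lam p - lam (Suc p)) * (\<Prod>q\<in>S. lam p - lam q))"
    "node_weight a lam n (Suc p) = a * ((lam (Suc p) - lam p) * (\<Prod>q\<in>S. lam (Suc p) - lam q))"
    by (simp_all add: node_weight_def poly_node_poly)
  then have "node_weight a lam n p * node_weight a lam n (Suc p) =
    - ((a * (lam p - lam (Suc p)))\<^sup>2 * (\<Prod>q\<in>S. (lam p - lam q) * (lam (Suc p) - lam q)))"
    unfolding prod.distrib power2_eq_square by (simp only:) (simp add: algebra_simps)
  moreover have "0 < (\<Prod>q\<in>S. (lam p - lam q) * (lam (Suc p) - lam q))"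
  proof (rule prod_pos)
    fix q assume q: "q \<in> S"
    show "0 < (lam p - lam q) * (lam (Suc p) - lam q)"
    proof (cases "q < p")
      case True
      then show ?thesis using q less[of q p] less[of q "Suc p"] assms(3) by (simp add: S_def)
    next
      case False
      then show ?thesis using q less[of p q] less[of "Suc p" q] assms(3)
        by (intro mult_neg_neg) (auto simp: S_def)
    qed
  qed
  moreover have "lam p - lam (Suc p) \<noteq> 0" using less[of p "Suc p"] assms(3) by auto
  ultimately show ?thesis using assms(2) by (simp add: zero_less_mult_iff)
qed

lemma coeff_mult_degree_le:
  fixes p q :: "'a :: comm_semiring_0 poly"
  assumes "degree p \<le> i" "degree q \<le> j"
  shows "coeff (p * q) (i + j) = coeff p i * coeff q j"
proof -
  have "coeff (p * q) (i + j) = (\<Sum>k\<le>i + j. if k = i then coeff p i * coeff q j else 0)"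
    unfolding coeff_mult
  proof (intro sum.cong refl)
    fix k assume "k \<in> {..i + j}"
    show "coeff p k * coeff q (i + j - k) = (if k = i then coeff p i * coeff q j else 0)"
    proof (cases "k = i")
      case False
      then have "k > i \<or> i + j - k > j" using \<open>k \<in> {..i + j}\<close> by auto
      then have "coeff p k = 0 \<or> coeff q (i + j - k) = 0"
        using assms by (auto intro: coeff_eq_0)
      with False show ?thesis by auto
    qed simp
  qed
  also have "\<dots> = coeff p i * coeff q j" by simp
  finally show ?thesis .
qed

text \<open>Reflection multiplies the coefficient of degree \<open>n\<close> by
  \<open>(-1)^n\<close>. In degree \<open>2 n\<close> the relation thus has coefficient
  \<open>2 (-1)^n\<close> times those of \<open>A\<close> and \<open>C\<close>, because
  \<open>B\<close> contributes nothing there.\<close>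

lemma coeff_top_eq_0:
  fixes A B C :: "real poly"
  assumes "degree C \<le> n" "degree A \<le> n" "degree B < n" "coeff A n \<noteq> 0"
    and rel: "\<And>x. poly C x * poly A (- x) - poly B x * poly B (- x) + poly A x * poly C (- x) = 0"
  shows "coeff C n = 0"
proof -
  define refl :: "real poly \<Rightarrow> real poly" where "refl p = pcompose p [:0, -1:]" for p
  have poly_refl: "poly (refl p) x = poly p (- x)" for p x by (simp add: refl_def poly_pcompose)
  have deg: "degree (refl p) = degree p" for p by (simp add: refl_def degree_pcompose)
  have coeff: "coeff (refl p) i = (-1) ^ i * coeff p i" for p i
    unfolding refl_def by (rule coeff_pcompose_linear)
  have "poly (C * refl A - B * refl B + A * refl C) = poly 0"
    using rel by (intro ext) (simp add: poly_refl)
  then have "C * refl A - B * refl B + A * refl C = 0" by (rule poly_eq_poly_eq_iff[THEN iffD1])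
  then have "coeff (C * refl A - B * refl B + A * refl C) (n + n) = 0" by simp
  moreover have "coeff (B * refl B) (n + n) = coeff B n * coeff (refl B) n"
    using assms(3) by (intro coeff_mult_degree_le) (auto simp: deg)
  moreover have "coeff B n = 0" using assms(3) by (rule coeff_eq_0)
  moreover have "coeff (C * refl A) (n + n) = coeff C n * coeff (refl A) n"
    "coeff (A * refl C) (n + n) = coeff A n * coeff (refl C) n"
    using assms(1,2) by (auto intro!: coeff_mult_degree_le simp: deg)
  ultimately have "2 * ((-1) ^ n * coeff A n * coeff C n) = 0"
    unfolding coeff_add coeff_diff coeff by (simp only: mult.assoc mult.left_commute mult.commute)
  then show ?thesis using assms(4) by simp
qed

text \<open>
  The multiplier \<open>2 * mu\<close> is chosen to cancel the leading coefficient of \<open>A\<close>. The zeros of \<open>C\<close>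
  and \<open>A\<close> interlace, which places exactly one positive zero of \<open>A1\<close> between consecutive \<open>lam p\<close>.
\<close>

lemma spectral_polys_peel_mass:
  assumes sp: "spectral_polys (Suc n) a lam C B A" and n: "0 < n"
  obtains mu a1 lam1 A1 where "0 < mu" "A = A1 - smult (2 * mu) (pCons 0 C)"
    "lam1 0 = 0" "strict_mono_on {..<n} lam1" "node_weight a1 lam1 n 0 < 0"
    "A1 = node_poly a1 lam1 {..<n}" "a * a1 < 0"
    "\<And>j. j \<in> {1..<n} \<Longrightarrow> poly B (lam1 j) / node_weight a1 lam1 n j < 0"
    "coeff B n / a < 0"
proof -
  let ?w = "node_weight a lam (Suc n)"
  from sp have lam0: "lam 0 = 0" and mono: "strict_mono_on {..<Suc n} lam" and w0: "?w 0 < 0"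
    and A: "A = node_poly a lam {..<Suc n}" and degB: "degree B < Suc n" and degC: "degree C < Suc n"
    and B0: "poly B 0 = 0" and C0: "poly C 0 = 1"
    and rel: "\<And>x. poly C x * poly A (- x) - poly B x * poly B (- x) + poly A x * poly C (- x) = 0"
    and neg: "\<And>p. p \<in> {1..<Suc n} \<Longrightarrow> poly B (lam p) / ?w p < 0"
    by (auto simp: spectral_polys_def)
  have a: "a \<noteq> 0" using w0 lam0 by (auto simp: node_weight_0_eq)
  have inj: "inj_on lam {..<Suc n}" using mono by (rule strict_mono_on_imp_inj_on)
  have less: "lam i < lam j \<longleftrightarrow> i < j" if "i < Suc n" "j < Suc n" for i j
    using strict_mono_on_less[OF mono] that by auto
  have lam_pos: "0 < lam p" if "0 < p" "p < Suc n" for p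
    using strict_mono_on_lessThan_pos[OF lam0 mono that] .
  have split: "{..<Suc n} = insert 0 {1..<Suc n}" by auto
  have w: "?w p \<noteq> 0" if "p < Suc n" for p using node_weight_nonzero[OF inj a that] .
  have Apos: "0 < poly A (- x)" if "0 < x" for x
    unfolding A using node_poly_pos_on_negative_axis[OF lam0 mono w0 _ that] by simp
  \<comment> \<open>In the partial fractions of \<open>B / A\<close> at a negative point, residues
    and denominators are all negative.\<close>
  have Bpos: "0 < poly B (- x)" if x: "0 < x" for x
  proof -
    have "- x \<noteq> lam p" if "p < Suc n" for p
      using lam_pos[of p] lam0 x that by (cases "p = 0") auto
    then have "poly B (- x) / poly A (- x) = (\<Sum>p<Suc n. poly B (lam p) / ?w p / (- x - lam p))"
      unfolding A by (subst lagrange_interpolation[OF inj a degB], subst poly_fraction_poly)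
        (use Apos[OF x] in \<open>auto simp: A\<close>)
    also have "\<dots> = (\<Sum>p\<in>{1..<Suc n}. poly B (lam p) / ?w p / (- x - lam p))"
      unfolding split using lam0 B0 by simp
    also have "\<dots> > 0"
    proof (rule sum_pos)
      fix p assume p: "p \<in> {1..<Suc n}"
      then have "- x - lam p < 0" using lam_pos[of p] x by auto
      then show "0 < poly B (lam p) / ?w p / (- x - lam p)"
        using neg[OF p] by (rule divide_neg_neg[rotated])
    qed (use n in auto)
    finally show ?thesis using Apos[OF x] by (simp add: zero_less_divide_iff)
  qed
  \<comment> \<open>The residues of \<open>C / A\<close>. They are negative because at a zero
    \<open>x > 0\<close> of \<open>A\<close> the relation reads
    \<open>C(x) A(-x) = B(x) B(-x)\<close>; at the origin \<open>C\<close> is \<open>1\<close> and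
    the weight is negative.\<close>
  define kap where "kap p = poly C (lam p) / ?w p" for p
  have kap_neg: "kap p < 0" if "p < Suc n" for p
  proof (cases "p = 0")
    case True
    then show ?thesis using w0 lam0 C0 by (simp add: kap_def)
  next
    case False
    then have p: "p \<in> {1..<Suc n}" "0 < lam p" using that lam_pos by auto
    have "poly A (lam p) = 0" using that poly_node_poly_node[of "{..<Suc n}" p] by (simp add: A)
    then have "poly C (lam p) * poly A (- lam p) = poly B (lam p) * poly B (- lam p)"
      using rel[of "lam p"] by simp
    then have "kap p = poly B (lam p) / ?w p * (poly B (- lam p) / poly A (- lam p))"
      using Apos[OF p(2)] w[OF that] by (simp add: kap_def field_simps)
    then show ?thesis
      using mult_neg_pos[OF neg[OF p(1)] divide_pos_pos[OF Bpos[OF p(2)] Apos[OF p(2)]]] by simp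
  qed
  define S where "S = (\<Sum>p<Suc n. kap p)"
  have top: "coeff g n = a * (\<Sum>p<Suc n. poly g (lam p) / ?w p)" if "degree g < Suc n" for g
    using residue_sum_eq_coeff[OF inj a that] a by (simp add: residue_sum_def)
  have cC: "coeff C n = a * S" using top[OF degC] by (simp add: S_def kap_def)
  have "(\<Sum>p\<in>{1..<Suc n}. kap p) < 0"
    using n kap_neg sum_pos[of "{1..<Suc n}" "\<lambda>p. - kap p"] by (auto simp: sum_negf)
  moreover have "kap 0 = 1 / ?w 0" using lam0 C0 by (simp add: kap_def)
  ultimately have S: "S < 1 / ?w 0" "1 / ?w 0 < 0" unfolding S_def split using w0 by auto
  \<comment> \<open>The coefficient of \<open>C\<close> in degree \<open>n\<close> is
    \<open>a * S\<close>, so this gives \<open>2 * mu * (a * S) = - a\<close>.\<close>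
  define mu where "mu = - 1 / (2 * S)"
  have "S < 0" using S by linarith
  then have mu: "0 < mu" by (simp add: mu_def)
  \<comment> \<open>The remaining mass stays positive: the positive nodes make \<open>S\<close>
    strictly smaller than \<open>kap 0 = 1 / ?w 0\<close>.\<close>
  have mu2: "?w 0 + 2 * mu < 0" using S \<open>S < 0\<close> w0 by (simp add: mu_def field_simps)
  define A1 where "A1 = A + smult (2 * mu) (pCons 0 C)"
  have polyA1: "poly A1 x = poly A x + 2 * mu * x * poly C x" for x
    by (simp add: A1_def)
  have cA: "coeff A (Suc n) = a" and degA: "degree A \<le> Suc n"
    using degree_node_poly[of "{..<Suc n}" a lam] by (simp_all add: A)
  have "degree A1 \<le> Suc n"
    unfolding A1_def using degA degC
    by (intro degree_add_le order.trans[OF degree_smult_le] order.trans[OF degree_pCons_le]) auto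
  moreover have "coeff A1 (Suc n) = 0"
    using cA cC \<open>S < 0\<close> by (simp add: A1_def mu_def)
  ultimately have degA1: "degree A1 \<le> n"
    by (metis le_SucE leading_coeff_0_iff degree_0 le0)
  have "\<exists>x. lam j < x \<and> x < lam (Suc j) \<and> poly A1 x = 0" if j: "j \<in> {1..<n}" for j
  proof -
    \<comment> \<open>At a zero of \<open>A\<close> only the term with \<open>C\<close> survives.
      Since \<open>kap\<close> keeps its sign while the weights alternate, \<open>A1\<close> changes
      sign between consecutive positive nodes.\<close>
    have val: "poly A1 (lam p) = 2 * mu * lam p * kap p * ?w p" if "p < Suc n" for p
    proof -
      have "poly A (lam p) = 0" using that poly_node_poly_node[of "{..<Suc n}" p] by (simp add: A)
      then show ?thesis using w[OF that] by (simp add: polyA1 kap_def)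
    qed
    have "0 < (2 * mu * lam j * (2 * mu * lam (Suc j))) * (kap j * kap (Suc j))"
      using mu lam_pos[of j] lam_pos[of "Suc j"] kap_neg[of j] kap_neg[of "Suc j"] j
      by (intro mult_pos_pos mult_neg_neg) auto
    moreover have "?w j * ?w (Suc j) < 0"
      using node_weight_alternates[OF mono a, of j] j by simp
    ultimately have "(2 * mu * lam j * (2 * mu * lam (Suc j))) * (kap j * kap (Suc j)) *
        (?w j * ?w (Suc j)) < 0"
      by (rule mult_pos_neg)
    then have "poly A1 (lam j) * poly A1 (lam (Suc j)) < 0"
      using j by (simp add: val mult_ac)
    then show ?thesis using poly_IVT[of "lam j" "lam (Suc j)" A1] less[of j "Suc j"] j by auto
  qed
  then obtain f where f: "\<And>j. j \<in> {1..<n} \<Longrightarrow> lam j < f j \<and> f j < lam (Suc j) \<and> poly A1 (f j) = 0"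
    by metis
  define lam1 where "lam1 = f(0 := 0)"
  have lam1_0: "lam1 0 = 0" by (simp add: lam1_def)
  have lam1: "lam j < lam1 j" "lam1 j < lam (Suc j)" "poly A1 (lam1 j) = 0" if "j \<in> {1..<n}" for j
    using f[OF that] that by (auto simp: lam1_def)
  have lam1_less: "lam1 i < lam1 j" if "i < j" "j < n" for i j
  proof (cases "i = 0")
    case True
    then show ?thesis using that lam1(1)[of j] lam_pos[of j] by (simp add: lam1_0)
  next
    case False
    have "lam (Suc i) \<le> lam j" using that less[of "Suc i" j] by (cases "Suc i = j") auto
    then show ?thesis using False that lam1(2)[of i] lam1(1)[of j] by simp
  qed
  have mono1: "strict_mono_on {..<n} lam1"
    using lam1_less by (intro strict_mono_onI) auto
  have inj1: "inj_on lam1 {..<n}" using mono1 by (rule strict_mono_on_imp_inj_on)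
  define a1 where "a1 = coeff A1 n"
  have "poly A 0 = 0" using poly_node_poly_node[of "{..<Suc n}" 0 a lam] by (simp add: A lam0)
  then have "poly A1 (lam1 q) = 0" if "q < n" for q
    using that lam1(3)[of q] by (cases "q = 0") (auto simp: lam1_0 polyA1)
  then have A1: "A1 = node_poly a1 lam1 {..<n}"
    using node_poly_eqI[OF inj1, of A1] degA1 by (simp add: a1_def)
  have w1: "node_weight a1 lam1 n 0 = ?w 0 + 2 * mu"
  proof -
    have "node_weight a1 lam1 n 0 = coeff A1 1"
      using node_weight_0[of lam1 n a1] lam1_0 n by (simp add: A1)
    also have "\<dots> = coeff A 1 + 2 * mu * coeff C 0" by (simp add: A1_def)
    also have "\<dots> = ?w 0 + 2 * mu"
      using node_weight_0[of lam "Suc n" a] lam0 C0 by (simp add: A poly_0_coeff_0)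
    finally show ?thesis .
  qed
  \<comment> \<open>Both slopes at the origin are negative; written as products they differ in sign
    by the one extra factor \<open>- lam n\<close>, so the leading coefficients are
    opposite.\<close>
  have aa1: "a * a1 < 0"
  proof -
    let ?P = "\<Prod>q\<in>{1..<n}. lam q * lam1 q"
    have P: "0 < ?P"
      using lam_pos lam1_less[of 0] lam1_0 by (intro prod_pos ballI mult_pos_pos) auto
    have "(\<Prod>q\<in>{1..<n}. - lam q) * (\<Prod>q\<in>{1..<n}. - lam1 q) = ?P"
      unfolding prod.distrib[symmetric] by (rule prod.cong) simp_all
    moreover have "{1..<Suc n} = insert n {1..<n}" using n by auto
    then have "?w 0 * node_weight a1 lam1 n 0 =
      (a * a1) * - lam n * ((\<Prod>q\<in>{1..<n}. - lam q) * (\<Prod>q\<in>{1..<n}. - lam1 q))"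
      using lam0 lam1_0 by (simp add: node_weight_0_eq)
    moreover have "0 < ?w 0 * node_weight a1 lam1 n 0"
      using w0 w1 mu2 by (simp add: mult_neg_neg)
    ultimately have "0 < (a * a1) * (- lam n * ?P)" by (simp add: mult.assoc)
    moreover have "- lam n * ?P < 0" using P lam_pos[of n] n by (intro mult_neg_pos) auto
    ultimately show ?thesis
      using mult_nonneg_nonpos[of "a * a1" "- lam n * ?P"] by (meson leD leI less_imp_le)
  qed
  have "poly B (lam1 j) / node_weight a1 lam1 n j < 0" if j: "j \<in> {1..<n}" for j
  proof -
    let ?y = "lam1 j" and ?w1 = "node_weight a1 lam1 n j"
    have y: "0 < ?y" using lam1_less[of 0 j] lam1_0 j by simp
    \<comment> \<open>Factors of equal index are paired: by interlacing \<open>?y - lam q\<close>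
      and \<open>?y - lam1 q\<close> have the same sign. The unpaired factors at \<open>j\<close>
      and \<open>n\<close> have opposite signs, as do \<open>a\<close> and
      \<open>a1\<close>.\<close>
    have "poly A ?y * ?w1 > 0"
    proof -
      let ?S = "{..<n} - {j}"
      have "{..<Suc n} = insert j (insert n ?S)" using j by auto
      moreover have "j \<notin> ?S" "n \<notin> ?S" "j \<noteq> n" "finite ?S" using j by auto
      ultimately have "poly A ?y = a * ((?y - lam j) * ((?y - lam n) * (\<Prod>q\<in>?S. ?y - lam q)))"
        unfolding A poly_node_poly by simp
      moreover have "?w1 = a1 * (\<Prod>q\<in>?S. ?y - lam1 q)"
        by (simp only: node_weight_def poly_node_poly)
      ultimately have "poly A ?y * ?w1 =
        (a * a1) * ((?y - lam j) * (?y - lam n)) * (\<Prod>q\<in>?S. (?y - lam q) * (?y - lam1 q))"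
        unfolding prod.distrib by (simp only: mult_ac)
      moreover have "0 < (\<Prod>q\<in>?S. (?y - lam q) * (?y - lam1 q))"
      proof (rule prod_pos)
        fix q assume q: "q \<in> ?S"
        show "0 < (?y - lam q) * (?y - lam1 q)"
        proof (cases "q < j")
          case True
          then show ?thesis using lam1_less[of q j] lam1(1)[OF j] less[of q j] j by simp
        next
          case False
          then have "j < q" "q < n" using q by auto
          moreover have "lam (Suc j) \<le> lam q"
            using calculation less[of "Suc j" q] by (cases "Suc j = q") auto
          ultimately show ?thesis using lam1_less[of j q] lam1(2)[OF j]
            by (intro mult_neg_neg) auto
        qed
      qed
      moreover have "lam (Suc j) \<le> lam n"
        using j less[of "Suc j" n] by (cases "Suc j = n") auto
      then have "(?y - lam j) * (?y - lam n) < 0"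
        using lam1(1,2)[OF j] by (intro mult_pos_neg) auto
      ultimately show ?thesis using aa1 by (simp add: mult_neg_neg)
    qed
    moreover have CA: "2 * mu * ?y * poly C ?y = - poly A ?y"
      using lam1(3)[OF j] by (simp add: polyA1)
    ultimately have "0 < - (2 * mu * ?y) * (poly C ?y * ?w1)"
      by (simp add: mult.assoc[symmetric])
    then have Cw: "poly C ?y * ?w1 < 0"
      using mu y by (simp add: zero_less_mult_iff mult_less_0_iff)
    have pos: "0 < poly A1 (- ?y)"
      unfolding A1 using mu2 w1
      by (intro node_poly_pos_on_negative_axis[OF lam1_0 mono1 _ n y]) simp
    \<comment> \<open>The relation stays valid with \<open>A1\<close> in place of \<open>A\<close>,
      and at a zero of \<open>A1\<close> its last term vanishes.\<close>
    have "poly C ?y * poly A1 (- ?y) =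
      poly C ?y * poly A (- ?y) - (2 * mu * ?y * poly C ?y) * poly C (- ?y)"
      by (simp add: polyA1 algebra_simps)
    also have "\<dots> = poly B ?y * poly B (- ?y)"
      unfolding CA using rel[of ?y] by simp
    finally have "poly B ?y * poly B (- ?y) = poly C ?y * poly A1 (- ?y)" ..
    then have "(poly B ?y * poly B (- ?y)) * ?w1 = (poly C ?y * poly A1 (- ?y)) * ?w1"
      by (rule arg_cong)
    then have "(poly B ?y * ?w1) * poly B (- ?y) = (poly C ?y * ?w1) * poly A1 (- ?y)"
      by (simp only: mult_ac)
    also have "\<dots> < 0" using Cw pos by (rule mult_neg_pos)
    finally have "poly B ?y * ?w1 < 0" using Bpos[OF y] by (simp add: mult_less_0_iff)
    then show ?thesis by (auto simp: mult_less_0_iff divide_less_0_iff)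
  qed
  moreover have "coeff B n / a < 0"
  proof -
    have "(\<Sum>p<Suc n. poly B (lam p) / ?w p) = (\<Sum>p\<in>{1..<Suc n}. poly B (lam p) / ?w p)"
      unfolding split using lam0 B0 by simp
    also have "\<dots> < 0"
      using n neg sum_pos[of "{1..<Suc n}" "\<lambda>p. - (poly B (lam p) / ?w p)"]
      by (auto simp: sum_negf)
    finally show ?thesis using top[OF degB] a by simp
  qed
  moreover have "A = A1 - smult (2 * mu) (pCons 0 C)" by (simp add: A1_def)
  ultimately show thesis
    using that[of mu A1 lam1 a1] mu lam1_0 mono1 w1 mu2 A1 aa1 by simp
qed

text \<open>After the mass is removed the gap is inverted. The single parameter \<open>h\<close>
  must lower the degrees of both \<open>B\<close> and \<open>C\<close>; this works because the
  relation between the polynomials is invariant under the gap.\<close>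

lemma spectral_polys_peel:
  assumes sp: "spectral_polys (Suc n) a lam C B A" and n: "0 < n"
  obtains mu h a1 lam1 C1 B1 A1 where "0 < mu" "0 < h" "spectral_polys n a1 lam1 C1 B1 A1"
    "C = C1 + smult h B1 + smult (h\<^sup>2 / 2) A1" "B = B1 + smult h A1"
    "A = A1 - smult (2 * mu) (pCons 0 C)"
proof -
  obtain mu a1 lam1 A1 where mu: "0 < mu" and A: "A = A1 - smult (2 * mu) (pCons 0 C)"
    and lam1: "lam1 0 = 0" "strict_mono_on {..<n} lam1" "node_weight a1 lam1 n 0 < 0"
    and A1: "A1 = node_poly a1 lam1 {..<n}" and aa1: "a * a1 < 0"
    and neg: "\<And>j. j \<in> {1..<n} \<Longrightarrow> poly B (lam1 j) / node_weight a1 lam1 n j < 0"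
    and Ba: "coeff B n / a < 0"
    using spectral_polys_peel_mass[OF sp n] by metis
  from sp have degB: "degree B \<le> n" and degC: "degree C \<le> n"
    and B0: "poly B 0 = 0" and C0: "poly C 0 = 1"
    and rel: "\<And>x. poly C x * poly A (- x) - poly B x * poly B (- x) + poly A x * poly C (- x) = 0"
    by (auto simp: spectral_polys_def)
  \<comment> \<open>Chosen to cancel the coefficient of \<open>B\<close> in degree \<open>n\<close>;
    positivity comes from \<open>coeff B n / a < 0\<close> and \<open>a * a1 < 0\<close>.\<close>
  define h where "h = coeff B n / a1"
  define B1 where "B1 = B - smult h A1"
  define C1 where "C1 = C - smult h B1 - smult (h\<^sup>2 / 2) A1"
  have cA1: "coeff A1 n = a1" and degA1: "degree A1 \<le> n"
    using degree_node_poly[of "{..<n}" a1 lam1] by (simp_all add: A1)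
  have h: "0 < h"
    using Ba aa1 by (auto simp: h_def mult_less_0_iff divide_less_0_iff zero_less_divide_iff)
  have degB1: "degree B1 < n"
  proof -
    have "degree B1 \<le> n"
      unfolding B1_def using degB degA1 by (intro degree_diff_le order.trans[OF degree_smult_le]) auto
    moreover have "coeff B1 n = 0" using cA1 aa1 by (auto simp: B1_def h_def)
    ultimately show ?thesis using n by (metis degree_0 le_neq_implies_less leading_coeff_0_iff)
  qed
  have zero: "poly A1 0 = 0"
    using lam1(1) n by (auto simp: A1 poly_node_poly)
  have rel1: "poly C1 x * poly A1 (- x) - poly B1 x * poly B1 (- x) + poly A1 x * poly C1 (- x) = 0"
    for x
  proof -
    have "poly C1 x * poly A1 (- x) - poly B1 x * poly B1 (- x) + poly A1 x * poly C1 (- x) =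
      poly C x * poly A (- x) - poly B x * poly B (- x) + poly A x * poly C (- x)"
      by (simp add: A B1_def C1_def field_simps power2_eq_square)
    with rel show ?thesis by simp
  qed
  have degC1: "degree C1 < n"
  proof -
    have "degree C1 \<le> n"
      unfolding C1_def using degC degB1 degA1
      by (intro degree_diff_le order.trans[OF degree_smult_le]) auto
    moreover have "coeff A1 n \<noteq> 0" using aa1 unfolding cA1 by auto
    with calculation have "coeff C1 n = 0"
      using coeff_top_eq_0[OF _ degA1 degB1 _ rel1] by blast
    ultimately show ?thesis using n by (metis degree_0 le_neq_implies_less leading_coeff_0_iff)
  qed
  have "poly A1 (lam1 j) = 0" if "j < n" for j
    using that by (auto simp: A1 poly_node_poly)
  \<comment> \<open>\<open>B1\<close> and \<open>B\<close> agree at the zeros of \<open>A1\<close>,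
    which carries over the negative residues.\<close>
  then have "spectral_polys n a1 lam1 C1 B1 A1"
    unfolding spectral_polys_def using lam1 A1 degB1 degC1 B0 C0 rel1 neg zero
    by (auto simp: B1_def C1_def)
  moreover have "B = B1 + smult h A1" "C = C1 + smult h B1 + smult (h\<^sup>2 / 2) A1"
    by (simp_all add: B1_def C1_def)
  ultimately show thesis
    using that mu h A by blast
qed

lemma spectral_polys_string:
  assumes "spectral_polys n a lam C B A" "0 < n"
  shows "\<exists>m l. (\<forall>k\<in>{1..n}. 0 < m k) \<and> (\<forall>k\<in>{1..<n}. 0 < l k) \<and>
    phi0 m l n = C \<and> phi1 m l n = B \<and> phi2 m l n = A"
  using assms
proof (induction n arbitrary: a lam C B A)
  case (Suc n)
  show ?case
  proof (cases "n = 0")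
    case True
    with Suc.prems(1) have *: "lam 0 = 0" "node_weight a lam 1 0 < 0" "A = node_poly a lam {..<1}"
      "degree B = 0" "degree C = 0" "poly B 0 = 0" "poly C 0 = 1"
      by (auto simp: spectral_polys_def)
    have "C = 1" "B = 0"
      using *(4-7) by (metis degree_eq_zeroE poly_pCons mult_zero_left add_0_right pCons_0_0 pCons_one)+
    moreover have "A = smult a [:0, 1:]"
      using *(1,3) by (simp add: node_poly_def lessThan_Suc)
    moreover have "a < 0"
      using *(1,2) by (simp add: node_weight_0_eq)
    ultimately show ?thesis
      \<comment> \<open>A single mass gives \<open>A = - 2 m z\<close>, hence
        \<open>m = - a / 2\<close>; there is no gap to determine.\<close>
      using True by (intro exI[of _ "\<lambda>_. - a / 2"] exI[of _ "\<lambda>_. 1"]) (simp add: one_pCons)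
  next
    case False
    then obtain mu h a1 lam1 C1 B1 A1 where *: "0 < mu" "0 < h"
      and sp: "spectral_polys n a1 lam1 C1 B1 A1"
      and eq: "C = C1 + smult h B1 + smult (h\<^sup>2 / 2) A1" "B = B1 + smult h A1"
        "A = A1 - smult (2 * mu) (pCons 0 C)"
      using spectral_polys_peel[OF Suc.prems(1)] by blast
    obtain m l where ml: "\<forall>k\<in>{1..n}. 0 < m k" "\<forall>k\<in>{1..<n}. 0 < l k"
      "phi0 m l n = C1" "phi1 m l n = B1" "phi2 m l n = A1"
      using Suc.IH[OF sp] False by auto
    let ?m = "m(Suc n := mu)" and ?l = "l(n := h)"
    have "phi0 ?m ?l n = C1" "phi1 ?m ?l n = B1" "phi2 ?m ?l n = A1"
      using phi_cong[of n ?m m ?l l] ml(3-5) by auto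
    then have "phi0 ?m ?l (Suc n) = C" "phi1 ?m ?l (Suc n) = B" "phi2 ?m ?l (Suc n) = A"
      by (simp_all add: eq)
    moreover have "\<forall>k\<in>{1..Suc n}. 0 < ?m k" "\<forall>k\<in>{1..<Suc n}. 0 < ?l k"
      using ml(1,2) * by auto
    ultimately show ?thesis by blast
  qed
qed simp

text \<open>
  With \<open>W = B / A\<close> and \<open>Z = C / A\<close>, the relation between the polynomials is
  \<open>Z x + Z (- x) = W x * W (- x)\<close>, which forces the residues of \<open>Z\<close>.
\<close>

lemma spectral_polys_exist:
  fixes lam b :: "nat \<Rightarrow> real"
  assumes lam0: "lam 0 = 0" and mono: "strict_mono_on {..<n} lam" and n: "0 < n"
    and b: "\<And>k. k \<in> {1..<n} \<Longrightarrow> b k < 0" and b0: "b 0 = 0" and M: "0 < M"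
  obtains a C B A where "spectral_polys n a lam C B A" "node_weight a lam n 0 = - 2 * M"
    "B = fraction_poly a lam n b"
proof -
  \<comment> \<open>Normalised so that the slope of \<open>A\<close> at the origin is
    \<open>- 2 * M\<close>.\<close>
  define a where "a = - 2 * M / (\<Prod>q\<in>{1..<n}. - lam q)"
  have lam_pos: "0 < lam p" if "0 < p" "p < n" for p
    using strict_mono_on_lessThan_pos[OF lam0 mono that] .
  have "lam q \<noteq> 0" if "q \<in> {1..<n}" for q using lam_pos[of q] that by auto
  then have "(\<Prod>q\<in>{1..<n}. - lam q) \<noteq> 0" by simp
  then have w0: "node_weight a lam n 0 = - 2 * M" and a: "a \<noteq> 0"
    using lam0 M by (simp_all add: node_weight_0_eq a_def)
  have inj: "inj_on lam {..<n}" using mono by (rule strict_mono_on_imp_inj_on)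
  \<comment> \<open>For \<open>p > 0\<close> this is \<open>b p * W (- lam p)\<close>, the residue
    of \<open>W x * W (- x)\<close> at \<open>lam p\<close>.\<close>
  define g where "g p = - (\<Sum>q<n. b p * b q / (lam p + lam q))" for p
  \<comment> \<open>The pole at the origin cancels in \<open>Z x + Z (- x)\<close>; its coefficient
    is fixed by \<open>poly C 0 = 1\<close>.\<close>
  define z where "z p = g p + (if p = 0 then - 1 / (2 * M) else 0)" for p
  define A where "A = node_poly a lam {..<n}"
  define B where "B = fraction_poly a lam n b"
  define C where "C = fraction_poly a lam n z"
  define W where "W x = (\<Sum>p<n. b p / (x - lam p))" for x
  define Z where "Z x = (\<Sum>p<n. z p / (x - lam p))" for x
  have ZW: "Z x + Z (- x) = W x * W (- x)" if x: "\<And>p. p < n \<Longrightarrow> x \<noteq> lam p \<and> - x \<noteq> lam p" for x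
  proof -
    let ?t = "\<lambda>p q. b p * b q / (lam p + lam q)"
    have Z: "Z y = (\<Sum>p<n. g p / (y - lam p)) - 1 / (2 * M) / y" for y
    proof -
      have "Z y = (\<Sum>p<n. g p / (y - lam p) + (if p = 0 then - 1 / (2 * M) / y else 0))"
        unfolding Z_def by (intro sum.cong) (auto simp: z_def lam0 add_divide_distrib)
      also have "\<dots> = (\<Sum>p<n. g p / (y - lam p)) + - 1 / (2 * M) / y"
        using n by (simp add: sum.distrib)
      finally show ?thesis by simp
    qed
    have G: "(\<Sum>p<n. g p / (y - lam p)) = - (\<Sum>p<n. \<Sum>q<n. ?t p q / (y - lam p))" for y
      by (simp add: g_def sum_divide_distrib sum_negf)
    have "W x * W (- x) = (\<Sum>p<n. \<Sum>q<n. b p / (x - lam p) * (b q / (- x - lam q)))"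
      by (simp add: W_def sum_product)
    \<comment> \<open>Partial fractions in \<open>x\<close> separate the poles \<open>lam p\<close>
      and \<open>- lam q\<close>.\<close>
    also have "\<dots> = (\<Sum>p<n. \<Sum>q<n. - (?t p q / (x - lam p)) - ?t q p / (- x - lam q))"
    proof (intro sum.cong refl)
      fix p q assume pq: "p \<in> {..<n}" "q \<in> {..<n}"
      show "b p / (x - lam p) * (b q / (- x - lam q)) = - (?t p q / (x - lam p)) - ?t q p / (- x - lam q)"
      proof (cases "p = 0 \<or> q = 0")
        case True
        then show ?thesis using b0 by auto
      next
        case False
        then have "lam p + lam q \<noteq> 0" using lam_pos[of p] lam_pos[of q] pq by auto
        moreover have "x - lam p \<noteq> 0" "- x - lam q \<noteq> 0" using x[of p] x[of q] pq by auto
        ultimately show ?thesis by (simp add: divide_simps) (simp add: algebra_simps)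
      qed
    qed
    also have "\<dots> = - (\<Sum>p<n. \<Sum>q<n. ?t p q / (x - lam p)) - (\<Sum>p<n. \<Sum>q<n. ?t q p / (- x - lam q))"
      by (simp only: sum_subtractf sum_negf)
    also have "(\<Sum>p<n. \<Sum>q<n. ?t q p / (- x - lam q)) = (\<Sum>q<n. \<Sum>p<n. ?t q p / (- x - lam q))"
      by (rule sum.swap)
    finally show ?thesis using Z[of x] Z[of "- x"] G[of x] G[of "- x"] by simp
  qed
  have rel: "poly C x * poly A (- x) - poly B x * poly B (- x) + poly A x * poly C (- x) = 0" for x
  proof -
    define refl :: "real poly \<Rightarrow> real poly" where "refl p = pcompose p [:0, -1:]" for p
    have poly_refl: "poly (refl p) x = poly p (- x)" for p x by (simp add: refl_def poly_pcompose)
    define R where "R = C * refl A - B * refl B + A * refl C"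
    have R: "poly R x = 0" if "x \<notin> lam ` {..<n} \<union> (\<lambda>p. - lam p) ` {..<n}" for x
    proof -
      have x: "x \<noteq> lam p \<and> - x \<noteq> lam p" if "p < n" for p
      proof -
        have "x \<noteq> - lam p" "x \<noteq> lam p" using that \<open>x \<notin> _\<close> by auto
        then show ?thesis by auto
      qed
      then have "poly R x = poly A x * poly A (- x) * (Z x + Z (- x) - W x * W (- x))"
        unfolding R_def A_def B_def C_def Z_def W_def
        by (simp add: poly_refl poly_fraction_poly algebra_simps)
      then show ?thesis using ZW[OF x] by simp
    qed
    \<comment> \<open>The roots of \<open>R\<close> and finitely many poles cover the line, so
      \<open>R\<close> is the zero polynomial and the relation extends to the poles.\<close>
    have "R = 0"
    proof (rule ccontr)
      assume "R \<noteq> 0"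
      then have "finite {x. poly R x = 0}" by (rule poly_roots_finite)
      then have "finite ({x. poly R x = 0} \<union> (lam ` {..<n} \<union> (\<lambda>p. - lam p) ` {..<n}))" by simp
      moreover have "{x. poly R x = 0} \<union> (lam ` {..<n} \<union> (\<lambda>p. - lam p) ` {..<n}) = UNIV"
        using R by blast
      ultimately show False using infinite_UNIV_char_0 by metis
    qed
    then have "poly R x = 0" by simp
    then show ?thesis by (simp add: R_def poly_refl)
  qed
  have "poly B 0 = 0" "poly C 0 = 1"
    using poly_fraction_poly_node[OF n, of a lam b] poly_fraction_poly_node[OF n, of a lam z] M
    by (simp_all add: B_def C_def lam0 b0 w0 z_def g_def)
  moreover have "poly B (lam p) / node_weight a lam n p < 0" if "p \<in> {1..<n}" for p
    using that b node_weight_nonzero[OF inj a, of p] by (simp add: B_def poly_fraction_poly_node)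
  ultimately have "spectral_polys n a lam C B A"
    unfolding spectral_polys_def using lam0 mono w0 M rel degree_fraction_poly[OF n]
    by (auto simp: A_def B_def C_def)
  then show thesis using that w0 B_def by blast
qed

section \<open>The string defined by the determinant formulas\<close>

text \<open>Nonvanishing of the denominators is asserted separately, because division in HOL is
  total and the formulas alone would not express it.\<close>

theorem theorem4p21:
  fixes n :: nat and lam b m l :: "nat \<Rightarrow> real" and M :: real
  assumes "1 \<le> n"
    and "\<forall>k\<in>{1..<n}. 0 < lam k" and "strict_mono_on {1..<n} lam"
    and "\<forall>k\<in>{1..<n}. b k < 0"
    and "0 < M"
    and "\<forall>k\<in>{0..n-1}. m (n - k) =
           (D_det n lam b k)\<^sup>2 / (2 * A_det n lam b M (k + 1) * A_det n lam b M k)"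
    and "\<forall>k\<in>{1..n-1}. l (n - k) = - (2 * A_det n lam b M k / D'_det n lam b k)"
  shows "(\<forall>k\<in>{0..n-1}. A_det n lam b M (k + 1) * A_det n lam b M k \<noteq> 0) \<and>
         (\<forall>k\<in>{1..n-1}. D'_det n lam b k \<noteq> 0) \<and>
         (\<forall>j\<in>{1..n}. 0 < m j) \<and> (\<forall>j\<in>{1..<n}. 0 < l j) \<and>
         (\<exists>x. (\<forall>j\<in>{1..<n}. string_gap x j = l j) \<and>
              discrete_cubic_string n x m \<and>
              has_spectral_data n x m lam b M)"
proof -
  \<comment> \<open>Index \<open>0\<close> is reserved for the zero of \<open>A\<close> at the
    origin, where \<open>B / A\<close> has residue \<open>0\<close>.\<close>
  define lam' where "lam' = lam(0 := 0)"
  define b' where "b' = b(0 := 0)"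
  have n: "0 < n" using assms(1) by simp
  have lam0: "lam' 0 = 0" and lam': "\<And>p. p \<noteq> 0 \<Longrightarrow> lam' p = lam p"
    by (simp_all add: lam'_def)
  have mono: "strict_mono_on {..<n} lam'"
  proof (rule strict_mono_onI)
    fix i j assume "i \<in> {..<n}" "j \<in> {..<n}" "i < j"
    then show "lam' i < lam' j"
      using assms(2) strict_mono_onD[OF assms(3), of i j] by (cases "i = 0") (auto simp: lam'_def)
  qed
  obtain a C B A where sp: "spectral_polys n a lam' C B A"
    and w0: "node_weight a lam' n 0 = - 2 * M" and B: "B = fraction_poly a lam' n b'"
    by (rule spectral_polys_exist[OF lam0 mono n, of b' M])
      (use assms(4,5) in \<open>auto simp: b'_def\<close>)
  have A: "A = node_poly a lam' {..<n}" using sp by (simp add: spectral_polys_def)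
  have inj: "inj_on lam' {..<n}" using mono by (rule strict_mono_on_imp_inj_on)
  have a: "a \<noteq> 0" using w0 lam0 assms(5) by (auto simp: node_weight_0_eq)
  obtain m' l' where m': "\<forall>k\<in>{1..n}. 0 < m' k" and l': "\<forall>k\<in>{1..<n}. 0 < l' k"
    and phi: "phi0 m' l' n = C" "phi1 m' l' n = B" "phi2 m' l' n = A"
    using spectral_polys_string[OF sp n] by blast
  have b_eq: "b p = poly (phi1 m' l' n) (lam' p) / node_weight a lam' n p" if "p \<in> {1..<n}" for p
    using that node_weight_nonzero[OF inj a, of p]
    by (simp add: phi B poly_fraction_poly_node b'_def)
  interpret str: spectral_string n m' l' lam' b a
    using n m' l' lam0 mono phi(3) A b_eq by unfold_locales auto
  have M: "str.M = M" using str.w_0 w0 by simp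
  \<comment> \<open>The moments sum over \<open>{1..<n}\<close>, so the values placed at index
    \<open>0\<close> leave them unchanged.\<close>
  have "I_moment n lam' b = I_moment n lam b" "beta n lam' b = beta n lam b"
    by (auto simp: fun_eq_iff I_moment_def beta_def lam' intro!: sum.cong)
  then have dets: "A_det n lam' b = A_det n lam b" "D_det n lam' b = D_det n lam b"
    "D'_det n lam' b = D'_det n lam b"
    by - (intro ext, simp only: A_det_def D_det_def D'_det_def)+
  have m: "m j = m' j" if "j \<in> {1..n}" for j
  proof -
    have "n - j < n" "n - (n - j) = j" "n - j \<in> {0..n-1}" using that by auto
    then show ?thesis using str.mass_formula[of "n - j"] assms(6) by (metis M dets(1,2))
  qed
  have l: "l j = l' j" if "j \<in> {1..<n}" for j
  proof -
    have "0 < n - j" "n - j < n" "n - (n - j) = j" "n - j \<in> {1..n-1}" using that by auto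
    then show ?thesis using str.gap_formula[of "n - j"] assms(7) by (metis M dets(1,3))
  qed
  \<comment> \<open>Positions with the prescribed gaps, starting from
    \<open>x 1 = 0\<close>.\<close>
  define x where "x j = (\<Sum>i\<in>{1..<j}. l i)" for j
  have gap: "string_gap x j = l j" if "j \<in> {1..<n}" for j
    using that by (simp add: string_gap_def x_def)
  have phi': "phi1 m (string_gap x) n = B" "phi2 m (string_gap x) n = A"
    using phi_cong[of n m m' "string_gap x" l'] phi m l gap by auto
  have BA: "B_poly n x m = B" "A_poly n x m = A"
    by (simp_all add: B_poly_def A_poly_def string_vec_eq phi' numeral_2_eq_2)
  have split: "{..<n} = insert 0 {1..<n}" using n by auto
  have pA: "poly A z = a * (z * (\<Prod>k\<in>{1..<n}. z - lam k))" for z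
  proof -
    have "(\<Prod>k\<in>{1..<n}. z - lam' k) = (\<Prod>k\<in>{1..<n}. z - lam k)"
      by (intro prod.cong) (auto simp: lam')
    then show ?thesis unfolding A poly_node_poly split by (simp add: lam0)
  qed
  have zeros: "{z. 0 < z \<and> poly A z = 0} = lam ` {1..<n}"
    using assms(2) a by (auto simp: pA)
  have frac: "poly B z / poly A z = (\<Sum>k\<in>{1..<n}. b k / (z - lam k))" if "poly A z \<noteq> 0" for z
  proof -
    have "z \<noteq> lam' p" if "p < n" for p
      using that \<open>poly A z \<noteq> 0\<close> poly_node_poly_node[of "{..<n}" p a lam'] by (auto simp: A)
    then have "poly B z = poly A z * (\<Sum>p<n. b' p / (z - lam' p))"
      unfolding A B by (rule poly_fraction_poly)
    moreover have "(\<Sum>p<n. b' p / (z - lam' p)) = (\<Sum>k\<in>{1..<n}. b' k / (z - lam' k))"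
      unfolding split by (simp add: b'_def)
    moreover have "\<dots> = (\<Sum>k\<in>{1..<n}. b k / (z - lam k))"
      by (intro sum.cong) (auto simp: lam' b'_def)
    ultimately show ?thesis using that by simp
  qed
  have "M = (\<Sum>k\<in>{1..n}. m k)"
    using M m by (simp add: str.M_def)
  then have "has_spectral_data n x m lam b M"
    using assms(3) zeros frac by (simp add: has_spectral_data_def BA)
  moreover have "discrete_cubic_string n x m"
    unfolding discrete_cubic_string_def
  proof (intro conjI ballI)
    fix k assume "k \<in> {1..<n}"
    then have "0 < string_gap x k" using gap l l' by simp
    then show "x k < x (k + 1)" by (simp add: string_gap_def)
  qed (use m m' in auto)
  moreover have "A_det n lam b M k > 0" if "k \<le> n" for k
    using str.A_det_pos[OF that] by (simp add: M dets)
  then have "A_det n lam b M k \<noteq> 0" if "k \<le> n" for k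
    using that by (metis less_irrefl)
  then have "\<forall>k\<in>{0..n-1}. A_det n lam b M (k + 1) * A_det n lam b M k \<noteq> 0"
    using n by auto
  moreover have "\<forall>k\<in>{1..n-1}. D'_det n lam b k \<noteq> 0"
    using str.D'_det_nonzero n by (auto simp: dets)
  moreover have "\<forall>j\<in>{1..n}. 0 < m j" "\<forall>j\<in>{1..<n}. 0 < l j" "\<forall>j\<in>{1..<n}. string_gap x j = l j"
    using m m' l l' gap by auto
  ultimately show ?thesis by blast
qed

end
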